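(* Let $n\ge 1$, let $m\ge 2$ be even, let $p$ be a divisor of $m$, let $G=G(m,p,n)$ and $\mu(G)=W_{\mathcal C,\mathcal C'}$, where $\mathcal C,\mathcal C'$ are the subgroups of $\mathbb C^\times$ of orders $m$ and $\frac mp$ respectively. Let $R=\mathbb Z\big[\frac{1+\mathbf i}{2}\big]\subset\mathbb C$, $\mathbf i=\sqrt{-1}$. Then the group rings $RG$ and $R\mu(G)$ are isomorphic as $R$-algebras. In particular, $\mathbb CG\cong\mathbb C\mu(G)$.
   Context: $\mathbb G_n=(\mathbb C^\times)^n\rtimes\mathbb S_n\subset\mathrm{GL}_n(\mathbb C)$ is the group of monomial matrices, with $(\mathbb C^\times)^n$ the diagonal matrices and $\mathbb S_n$ the permutation matrices; each element is uniquely $tw$ with $t\in(\mathbb C^\times)^n$, $w\in\mathbb S_n$. $\det$ is the matrix determinant. For finite subgroups $\mathcal C'\subseteq\mathcal C$ of $\mathbb C^\times$ of orders $\frac mp$ and $m$, $$G(m,p,n)=\{tw\in\mathcal C^n\rtimes\mathbb S_n:\det t\in\mathcal C'\},\qquad W_{\mathcal C,\mathcal C'}=\{tw\in\mathcal C^n\rtimes\mathbb S_n:\det(tw)\in\mathcal C'\}.$$ *)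

theory Defs
  imports
    Complex_Main
    "HOL-Algebra.Generated_Rings"
    "HOL-Algebra.QuotRing"
    "Jordan_Normal_Form.VS_Connect"
begin

section \<open>Group rings\<close>

text \<open>
  Elements are the finitely supported functions from the group to the coefficients, made
  extensional (\<open>undefined\<close> outside the carrier of \<open>G\<close>) so that equality of functions is equality
  of elements. The product is convolution, \<open>(f h)(x) = \<Sum>\<^sub>y f(y) h(y\<^sup>-\<^sup>1 x)\<close>. HOL-Algebra's locale
  \<open>algebra\<close> only covers commutative algebras, so the record type \<open>module\<close> is used just to
  carry the ring operations and the scalar multiplication.
\<close>

definition group_ring ::
  "('r, 'k) ring_scheme \<Rightarrow> ('g, 'l) monoid_scheme \<Rightarrow> ('r, 'g \<Rightarrow> 'r) module" where
  "group_ring R G = \<lparr>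
     carrier = {f \<in> carrier G \<rightarrow>\<^sub>E carrier R. finite {x \<in> carrier G. f x \<noteq> \<zero>\<^bsub>R\<^esub>}},
     mult = (\<lambda>f h. \<lambda>x\<in>carrier G.
       \<Oplus>\<^bsub>R\<^esub>y\<in>{y \<in> carrier G. f y \<noteq> \<zero>\<^bsub>R\<^esub>}. f y \<otimes>\<^bsub>R\<^esub> h (inv\<^bsub>G\<^esub> y \<otimes>\<^bsub>G\<^esub> x)),
     one = (\<lambda>x\<in>carrier G. if x = \<one>\<^bsub>G\<^esub> then \<one>\<^bsub>R\<^esub> else \<zero>\<^bsub>R\<^esub>),
     zero = (\<lambda>x\<in>carrier G. \<zero>\<^bsub>R\<^esub>),
     add = (\<lambda>f h. \<lambda>x\<in>carrier G. f x \<oplus>\<^bsub>R\<^esub> h x),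
     smult = (\<lambda>a f. \<lambda>x\<in>carrier G. a \<otimes>\<^bsub>R\<^esub> f x)\<rparr>"

definition algebra_iso ::
  "('r, 'k) ring_scheme \<Rightarrow> ('r, 'a, 'l) module_scheme \<Rightarrow> ('r, 'b, 'm) module_scheme \<Rightarrow> ('a \<Rightarrow> 'b) set"
  where
  "algebra_iso R A B = {\<phi> \<in> ring_iso A B.
     \<forall>a\<in>carrier R. \<forall>x\<in>carrier A. \<phi> (a \<odot>\<^bsub>A\<^esub> x) = a \<odot>\<^bsub>B\<^esub> \<phi> x}"

definition algebra_isomorphic ::
  "('r, 'k) ring_scheme \<Rightarrow> ('r, 'a, 'l) module_scheme \<Rightarrow> ('r, 'b, 'm) module_scheme \<Rightarrow> bool"
  where
  "algebra_isomorphic R A B \<longleftrightarrow> algebra_iso R A B \<noteq> {}"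


section \<open>Coefficients\<close>

abbreviation complex_field :: "complex ring" where
  "complex_field \<equiv> class_ring"

abbreviation complex_units :: "complex monoid" where
  "complex_units \<equiv> units_of complex_field"

text \<open>The subring \<open>\<int>[(1 + \<i>)/2]\<close> of the complex numbers.\<close>

definition coeff_ring :: "complex ring" where
  "coeff_ring = complex_field\<lparr>carrier := generate_ring complex_field {(1 + \<i>) / 2}\<rparr>"


section \<open>Groups of monomial matrices\<close>

definition GL :: "nat \<Rightarrow> complex mat monoid" where
  "GL n = units_of (ring_mat TYPE(complex) n ())"

text \<open>The permutation matrix of \<open>\<sigma>\<close> sends the \<open>j\<close>-th standard basis vector to the \<open>\<sigma> j\<close>-th one.\<close>

definition perm_mat :: "nat \<Rightarrow> (nat \<Rightarrow> nat) \<Rightarrow> complex mat" where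
  "perm_mat n \<sigma> = mat n n (\<lambda>(i, j). if i = \<sigma> j then 1 else 0)"

definition perm_mats :: "nat \<Rightarrow> complex mat set" where
  "perm_mats n = {perm_mat n \<sigma> | \<sigma>. \<sigma> permutes {..<n}}"

definition diag_mats :: "complex set \<Rightarrow> nat \<Rightarrow> complex mat set" where
  "diag_mats C n = {mat_diag n d | d. \<forall>i<n. d i \<in> C}"

text \<open>
  With \<open>C\<close> and \<open>C'\<close> the subgroups of orders \<open>m\<close> and \<open>m/p\<close> of the multiplicative group of the
  complex numbers, \<open>imprimitive_group C C' n\<close> is \<open>G(m,p,n)\<close> and \<open>mystic_group C C' n\<close> is
  \<open>W\<close> for the pair \<open>C\<close>, \<open>C'\<close>.
\<close>

definition imprimitive_group :: "complex set \<Rightarrow> complex set \<Rightarrow> nat \<Rightarrow> complex mat monoid" where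
  "imprimitive_group C C' n =
     (GL n)\<lparr>carrier := {t * w | t w. t \<in> diag_mats C n \<and> w \<in> perm_mats n \<and> det t \<in> C'}\<rparr>"

definition mystic_group :: "complex set \<Rightarrow> complex set \<Rightarrow> nat \<Rightarrow> complex mat monoid" where
  "mystic_group C C' n =
     (GL n)\<lparr>carrier := {t * w | t w. t \<in> diag_mats C n \<and> w \<in> perm_mats n \<and> det (t * w) \<in> C'}\<rparr>"

end

theory Submission
  imports Defs
begin

text \<open>
  The mystic group consists of the products \<open>t \<sigma>'\<close> with \<open>det t \<in> C'\<close>, where
  \<open>\<sigma>'\<close> is Tits' lift of the permutation \<open>\<sigma>\<close>: a monomial matrix of determinant 1 with
  entries 0, 1 and -1. Let \<open>t\<^sub>a\<close> be the diagonal matrix with -1 in position \<open>a\<close> and 1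
  elsewhere. Then \<open>\<sigma>' \<tau>'\<close> is \<open>(\<sigma> \<tau>)'\<close> times the product of the \<open>t\<^sub>a t\<^sub>b\<close> over the pairs \<open>{a, b}\<close>
  that are inverted by \<open>\<tau>\<close> and inverted back by \<open>\<sigma>\<close>.
  Since \<open>\<i>\<close> and \<open>1/2\<close> belong to the coefficient ring, \<open>t\<^sub>a t\<^sub>b\<close> has the square root
  \<open>u\<^sub>a\<^sub>b = (1 + t\<^sub>a t\<^sub>b)/2 + \<i> (1 - t\<^sub>a t\<^sub>b)/2\<close> in the group ring. With \<open>u\<^sub>\<sigma>\<close> the product of
  the \<open>u\<^sub>a\<^sub>b\<close> over the inversions of \<open>\<sigma>\<close>, the same factor appears in \<open>u\<^sub>\<sigma> u\<^sub>\<tau>\<close>, so that the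
  elements \<open>\<sigma>' u\<^sub>\<sigma>\<close> multiply like the permutations, and \<open>t \<sigma> \<mapsto> t \<sigma>' u\<^sub>\<sigma>\<close> extends to an
  isomorphism from the group ring of \<open>G(m,p,n)\<close>.
\<close>

section \<open>Inversions of permutations\<close>

lemma permutes_less: "\<sigma> permutes {..<n::nat} \<Longrightarrow> j < n \<Longrightarrow> \<sigma> j < n"
  using permutes_in_image[of \<sigma> "{..<n}" j] by simp

text \<open>As an inequality of truth values, \<open>inverted (\<sigma> \<circ> \<tau>) a b\<close>
  is the exclusive or of \<open>inverted \<tau> a b\<close> and
  \<open>inverted \<sigma> (\<tau> a) (\<tau> b)\<close>, without any case distinction on the order
  of \<open>a\<close> and \<open>b\<close>.\<close>

definition inverted :: "(nat \<Rightarrow> nat) \<Rightarrow> nat \<Rightarrow> nat \<Rightarrow> bool" where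
  "inverted \<sigma> a b \<longleftrightarrow> (a < b) \<noteq> (\<sigma> a < \<sigma> b)"

lemma inverted_commute: "inj \<sigma> \<Longrightarrow> inverted \<sigma> a b = inverted \<sigma> b a"
  unfolding inverted_def by (metis injD linorder_neq_iff order_less_asym)

text \<open>
  Multiplying the columns of the permutation matrix of \<open>\<sigma>\<close> by these signs gives Tits' lift of \<open>\<sigma>\<close>,
  whose determinant is 1.
\<close>

definition lift_sign :: "nat \<Rightarrow> (nat \<Rightarrow> nat) \<Rightarrow> nat \<Rightarrow> complex" where
  "lift_sign n \<sigma> j = (\<Prod>k<n. if k < j \<and> \<sigma> j < \<sigma> k then -1 else 1)"

text \<open>
  With \<open>z = \<i>\<close>, this is the value of the unit \<open>u\<^sub>\<sigma>\<close> at the character of the sign vectors that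
  sends \<open>a\<close> to the product of the \<open>a j\<close> with \<open>j \<in> S\<close>.
\<close>

definition split_weight :: "complex \<Rightarrow> nat \<Rightarrow> (nat \<Rightarrow> nat) \<Rightarrow> nat set \<Rightarrow> complex" where
  "split_weight z n \<sigma> S = (\<Prod>a\<in>S. \<Prod>b\<in>{..<n} - S. if inverted \<sigma> a b then z else 1)"

text \<open>If \<open>z * z = -1\<close>, this is the defect in counting inversions by powers of
  \<open>z\<close>: a pair inverted by \<tau> and inverted back by \<sigma> contributes
  \<open>z * z\<close> to the separate weights of \<sigma> and \<tau>, but 1 to the weight of the
  composite.\<close>

definition reinversion_sign :: "(nat \<Rightarrow> nat) \<Rightarrow> (nat \<Rightarrow> nat) \<Rightarrow> nat \<Rightarrow> nat \<Rightarrow> complex" where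
  "reinversion_sign \<sigma> \<tau> a b = (if inverted \<tau> a b \<and> inverted \<sigma> (\<tau> a) (\<tau> b) then -1 else 1)"

section \<open>The cocycle of Tits' lift\<close>

lemma lift_sign_id: "lift_sign n id j = 1"
  unfolding lift_sign_def by (intro prod.neutral) auto

lemma lift_sign_cases: "lift_sign n \<sigma> j = 1 \<or> lift_sign n \<sigma> j = -1"
proof -
  have "(\<Prod>k\<in>A. if k < j \<and> \<sigma> j < \<sigma> k then -1 else 1 :: complex) \<in> {1, -1}" if "finite A" for A
    using that by induction auto
  from this[of "{..<n}"] show ?thesis unfolding lift_sign_def by auto
qed

lemma lift_sign_square [simp]: "lift_sign n \<sigma> j * lift_sign n \<sigma> j = 1"
  using lift_sign_cases[of n \<sigma> j] by auto

lemma lift_sign_nonzero [simp]: "lift_sign n \<sigma> j \<noteq> 0"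
  using lift_sign_cases[of n \<sigma> j] by auto

text \<open>Column \<open>j\<close> of the product of the lifts of \<sigma> and \<tau> carries the
  sign \<open>lift_sign n \<sigma> (\<tau> j) * lift_sign n \<tau> j\<close>; the third factor
  compares it with the lift of the composite. Once the first product is reindexed by \<tau>, the
  identity holds for each \<open>k\<close> separately: by injectivity, the orders of
  \<open>j\<close>, \<open>k\<close> and of their images are strict when \<open>k\<close> differs
  from \<open>j\<close>.\<close>

lemma lift_sign_cocycle:
  assumes \<sigma>: "\<sigma> permutes {..<n}" and \<tau>: "\<tau> permutes {..<n}"
  shows "lift_sign n \<sigma> (\<tau> j) * lift_sign n \<tau> j * lift_sign n (\<sigma> \<circ> \<tau>) j
         = (\<Prod>k<n. reinversion_sign \<sigma> \<tau> j k)"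
proof -
  have inj: "\<tau> k = \<tau> j \<longleftrightarrow> k = j" "\<sigma> (\<tau> k) = \<sigma> (\<tau> j) \<longleftrightarrow> k = j" for k
    by (simp_all add: inj_eq[OF permutes_inj[OF \<sigma>]] inj_eq[OF permutes_inj[OF \<tau>]])
  have "lift_sign n \<sigma> (\<tau> j)
      = (\<Prod>k<n. if \<tau> k < \<tau> j \<and> \<sigma> (\<tau> j) < \<sigma> (\<tau> k) then -1 else 1)"
    unfolding lift_sign_def
    by (rule prod.reindex_bij_betw[OF permutes_imp_bij[OF \<tau>], symmetric])
  then have "lift_sign n \<sigma> (\<tau> j) * lift_sign n \<tau> j * lift_sign n (\<sigma> \<circ> \<tau>) j =
      (\<Prod>k<n. (if \<tau> k < \<tau> j \<and> \<sigma> (\<tau> j) < \<sigma> (\<tau> k) then -1 else 1) *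
        (if k < j \<and> \<tau> j < \<tau> k then -1 else 1) *
        (if k < j \<and> \<sigma> (\<tau> j) < \<sigma> (\<tau> k) then -1 else 1))"
    by (simp add: lift_sign_def prod.distrib)
  also have "\<dots> = (\<Prod>k<n. reinversion_sign \<sigma> \<tau> j k)"
  proof (rule prod.cong)
    fix k
    show "(if \<tau> k < \<tau> j \<and> \<sigma> (\<tau> j) < \<sigma> (\<tau> k) then -1 else 1) *
        (if k < j \<and> \<tau> j < \<tau> k then -1 else 1) *
        (if k < j \<and> \<sigma> (\<tau> j) < \<sigma> (\<tau> k) then -1 else 1) = reinversion_sign \<sigma> \<tau> j k"
    proof (cases "k = j")
      case False
      then have "\<tau> k \<noteq> \<tau> j" "\<sigma> (\<tau> k) \<noteq> \<sigma> (\<tau> j)" using inj by auto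
      with False show ?thesis
        by (cases "k < j"; cases "\<tau> k < \<tau> j"; cases "\<sigma> (\<tau> k) < \<sigma> (\<tau> j)")
           (simp_all add: reinversion_sign_def inverted_def)
    qed (simp add: reinversion_sign_def inverted_def)
  qed simp
  finally show ?thesis .
qed

lemma reinversion_sign_commute:
  assumes "inj \<sigma>" "inj \<tau>"
  shows "reinversion_sign \<sigma> \<tau> a b = reinversion_sign \<sigma> \<tau> b a"
  using assms by (simp add: reinversion_sign_def inverted_commute)

text \<open>The factors at (a, b) and (b, a) are equal and cancel, since they are square roots of
  1.\<close>

lemma prod_symmetric_square_eq_1:
  fixes f :: "'a \<Rightarrow> 'a \<Rightarrow> 'b::comm_monoid_mult"
  assumes "finite S" and sym: "\<And>a b. f a b = f b a" and sq: "\<And>a b. f a b * f a b = 1"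
    and diag: "\<And>a. f a a = 1"
  shows "(\<Prod>a\<in>S. \<Prod>b\<in>S. f a b) = 1"
  using assms(1)
proof induction
  case (insert x F)
  have "(\<Prod>a\<in>F. f a x) * (\<Prod>a\<in>F. f x a) = (\<Prod>a\<in>F. f a x * f x a)"
    by (simp add: prod.distrib)
  also have "\<dots> = 1" by (rule prod.neutral) (metis sym sq)
  finally have "(\<Prod>a\<in>F. f a x) * (\<Prod>a\<in>F. f x a) = 1" .
  then show ?case using insert by (simp add: prod.distrib diag mult.commute)
qed simp

text \<open>With \<open>S = {..<n}\<close> this makes the product of all lift signs multiplicative;
  with general \<open>S\<close> it supplies the pairs inside \<open>S\<close> in the cocycle
  identity for \<open>split_weight\<close>.\<close>

lemma prod_reinversion_sign_eq_1:
  assumes "\<sigma> permutes {..<n}" and "\<tau> permutes {..<n}" and "finite S"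
  shows "(\<Prod>a\<in>S. \<Prod>b\<in>S. reinversion_sign \<sigma> \<tau> a b) = 1"
  using assms
  by (intro prod_symmetric_square_eq_1 reinversion_sign_commute)
     (auto simp: permutes_inj reinversion_sign_def inverted_def)

text \<open>Multiplying the cocycle identity over all columns gives a double product of symmetric
  signs, which is 1.\<close>

lemma prod_lift_sign_comp:
  assumes \<sigma>: "\<sigma> permutes {..<n}" and \<tau>: "\<tau> permutes {..<n}"
  shows "prod (lift_sign n (\<sigma> \<circ> \<tau>)) {..<n} = prod (lift_sign n \<sigma>) {..<n} * prod (lift_sign n \<tau>) {..<n}"
proof -
  have "prod (lift_sign n \<sigma>) {..<n} * prod (lift_sign n \<tau>) {..<n} * prod (lift_sign n (\<sigma> \<circ> \<tau>)) {..<n}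
      = (\<Prod>j<n. lift_sign n \<sigma> (\<tau> j) * lift_sign n \<tau> j * lift_sign n (\<sigma> \<circ> \<tau>) j)"
    by (simp add: prod.distrib prod.reindex_bij_betw[OF permutes_imp_bij[OF \<tau>]])
  also have "\<dots> = 1"
    by (simp add: lift_sign_cocycle[OF \<sigma> \<tau>] prod_reinversion_sign_eq_1[OF \<sigma> \<tau>] del: comp_apply)
  finally have *: "prod (lift_sign n \<sigma>) {..<n} * prod (lift_sign n \<tau>) {..<n} *
      prod (lift_sign n (\<sigma> \<circ> \<tau>)) {..<n} = 1" .
  \<comment> \<open>A product of signs is its own inverse, so the third factor in \<open>*\<close>
    can be moved to the other side.\<close>
  have "prod (lift_sign n (\<sigma> \<circ> \<tau>)) {..<n} * prod (lift_sign n (\<sigma> \<circ> \<tau>)) {..<n} = 1"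
    unfolding prod.distrib[symmetric] by (simp only: lift_sign_square prod.neutral_const)
  with * have "prod (lift_sign n (\<sigma> \<circ> \<tau>)) {..<n} * 1 =
      prod (lift_sign n \<sigma>) {..<n} * prod (lift_sign n \<tau>) {..<n} * 1"
    by (metis mult.assoc mult.commute)
  then show ?thesis by simp
qed

text \<open>The only inversion is the pair of 0 and 1, and it is counted at its larger entry
  1.\<close>

lemma prod_lift_sign_transpose_0_1:
  assumes "1 < n"
  shows "prod (lift_sign n (transpose 0 1)) {..<n} = -1"
proof -
  have "lift_sign n (transpose 0 1) j = (if j = 1 then -1 else 1)" for j
  proof (cases "j = 1")
    case True
    have "lift_sign n (transpose 0 1) j = (\<Prod>k<n. if k = 0 then -1 else 1)"
      unfolding lift_sign_def True by (intro prod.cong) (auto simp: transpose_def)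
    with True assms show ?thesis by simp
  next
    case False
    then show ?thesis
      unfolding lift_sign_def by (auto simp: transpose_def intro!: prod.neutral)
  qed
  then have "prod (lift_sign n (transpose 0 1)) {..<n} = (\<Prod>j<n. if j = 1 then -1 else 1)"
    by simp
  also have "\<dots> = -1" using assms by (simp add: prod.delta)
  finally show ?thesis .
qed

text \<open>Every transposition is conjugate to that of 0 and 1, and a multiplicative function with
  nonzero complex values is constant on conjugacy classes.\<close>

lemma prod_lift_sign_transpose:
  assumes "a < n" "b < n" "a \<noteq> b"
  shows "prod (lift_sign n (transpose a b)) {..<n} = -1"
proof -
  let ?F = "\<lambda>\<sigma>. prod (lift_sign n \<sigma>) {..<n}"
  have n: "1 < n" using assms by linarith
  \<comment> \<open>The conjugating permutation has to send 0 to \<open>a\<close> and 1 to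
    \<open>b\<close>. Here \<open>c\<close> is the preimage of \<open>b\<close> under the
    transposition of 0 and \<open>a\<close>; it is not 0 because \<open>b\<close> differs from
    \<open>a\<close>, so the inner transposition fixes 0.\<close>
  define c where "c = transpose 0 a b"
  define \<pi> where "\<pi> = transpose 0 a \<circ> transpose 1 c"
  have c: "c < n" "c \<noteq> 0" using assms by (auto simp: c_def transpose_def)
  have \<pi>: "\<pi> permutes {..<n}"
    unfolding \<pi>_def using assms n c by (intro permutes_compose permutes_swap_id) auto
  have "\<pi> 0 = a" "\<pi> 1 = b"
    using c by (simp_all add: \<pi>_def c_def)
  then have iff: "\<pi> x = a \<longleftrightarrow> x = 0" "\<pi> x = b \<longleftrightarrow> x = 1" for x
    using inj_eq[OF permutes_inj[OF \<pi>]] by metis+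
  have t: "transpose 0 1 permutes {..<n}" "transpose a b permutes {..<n}"
    using assms n by (simp_all add: permutes_swap_id)
  have "(transpose a b \<circ> \<pi>) x = (\<pi> \<circ> transpose 0 1) x" for x
    using \<open>\<pi> 0 = a\<close>[symmetric] \<open>\<pi> 1 = b\<close>[symmetric] iff[of x]
    by (cases "x = 0"; cases "x = 1") (simp_all add: transpose_apply_other)
  then have "transpose a b \<circ> \<pi> = \<pi> \<circ> transpose 0 1" by (rule ext)
  then have "?F (transpose a b) * ?F \<pi> = ?F \<pi> * ?F (transpose 0 1)"
    using prod_lift_sign_comp \<pi> t by metis
  then show ?thesis using prod_lift_sign_transpose_0_1[OF n] by simp
qed

text \<open>The column signs thus contribute exactly the sign of \<sigma> to a determinant. This is
  what exchanges the two determinant conditions in the twist.\<close>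

lemma prod_lift_sign:
  assumes "\<sigma> permutes {..<n}"
  shows "prod (lift_sign n \<sigma>) {..<n} = of_int (sign \<sigma>)"
  using assms finite_lessThan
proof (induction rule: permutes_induct)
  case (swap a b p)
  have p: "permutation p" using swap.hyps by (auto intro: permutation_permutes[THEN iffD2])
  have "prod (lift_sign n (transpose a b \<circ> p)) {..<n} = - of_int (sign p)"
    using swap by (subst prod_lift_sign_comp) (auto simp: permutes_swap_id prod_lift_sign_transpose)
  moreover have "sign (transpose a b \<circ> p) = - sign p"
    using swap.hyps by (subst sign_compose[OF permutation_swap_id p]) (simp add: sign_swap_id)
  ultimately show ?case by (simp only: of_int_minus)
qed (simp add: lift_sign_id del: id_apply flip: id_def)

section \<open>Values of the twisting units at characters\<close>

lemma split_weight_id: "split_weight z n id S = 1"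
  by (simp add: split_weight_def inverted_def)

lemma split_weight_inverse:
  assumes "z * w = 1"
  shows "split_weight z n \<sigma> S * split_weight w n \<sigma> S = 1"
  using assms unfolding split_weight_def prod.distrib[symmetric] by (intro prod.neutral) auto

text \<open>A pair is split by a set exactly when it is split by the complement. This invariance
  confines the twisting unit to sign vectors with product 1, by
  \<open>fourier_coeff_eq_0\<close>.\<close>

lemma split_weight_compl:
  assumes "inj \<sigma>" "S \<subseteq> {..<n}"
  shows "split_weight z n \<sigma> ({..<n} - S) = split_weight z n \<sigma> S"
proof -
  have "{..<n} - ({..<n} - S) = S" using assms by auto
  then show ?thesis
    unfolding split_weight_def
    by (subst prod.swap) (simp add: inverted_commute[OF assms(1)])
qed

text \<open>
  Writing a split pair as an ordered pair with its first entry in \<open>S\<close> makes reindexing by a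
  permutation immediate. Pairs inside \<open>S\<close> contribute twice, hence nothing, to the right-hand side.
\<close>

lemma split_weight_cocycle:
  assumes \<sigma>: "\<sigma> permutes {..<n}" and \<tau>: "\<tau> permutes {..<n}" and S: "S \<subseteq> {..<n}" and z: "z * z = -1"
  shows "split_weight z n \<sigma> (\<tau> ` S) * split_weight z n \<tau> S =
         split_weight z n (\<sigma> \<circ> \<tau>) S *
         (\<Prod>j\<in>S. lift_sign n \<sigma> (\<tau> j) * lift_sign n \<tau> j * lift_sign n (\<sigma> \<circ> \<tau>) j)"
proof -
  have fin: "finite S" using S finite_subset by blast
  have inj: "inj \<tau>" using permutes_inj[OF \<tau>] .
  have compl: "{..<n} - \<tau> ` S = \<tau> ` ({..<n} - S)"
    using inj permutes_image[OF \<tau>] by (simp add: image_set_diff)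
  have "split_weight z n \<sigma> (\<tau> ` S) * split_weight z n \<tau> S =
      (\<Prod>a\<in>S. \<Prod>b\<in>{..<n} - S. (if inverted \<sigma> (\<tau> a) (\<tau> b) then z else 1) *
        (if inverted \<tau> a b then z else 1))"
    unfolding split_weight_def compl
    using inj by (simp add: prod.reindex inj_on_subset[OF inj] prod.distrib)
  also have "\<dots> = (\<Prod>a\<in>S. \<Prod>b\<in>{..<n} - S. (if inverted (\<sigma> \<circ> \<tau>) a b then z else 1) *
        reinversion_sign \<sigma> \<tau> a b)"
    using z by (intro prod.cong refl) (auto simp: inverted_def reinversion_sign_def)
  also have "\<dots> = split_weight z n (\<sigma> \<circ> \<tau>) S * (\<Prod>a\<in>S. \<Prod>b\<in>{..<n} - S. reinversion_sign \<sigma> \<tau> a b)"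
    by (simp add: split_weight_def prod.distrib)
  also have "(\<Prod>a\<in>S. \<Prod>b\<in>{..<n} - S. reinversion_sign \<sigma> \<tau> a b)
      = (\<Prod>a\<in>S. \<Prod>b\<in>{..<n} - S. reinversion_sign \<sigma> \<tau> a b) *
        (\<Prod>a\<in>S. \<Prod>b\<in>S. reinversion_sign \<sigma> \<tau> a b)"
    by (simp add: prod_reinversion_sign_eq_1[OF \<sigma> \<tau> fin])
  also have "\<dots> = (\<Prod>a\<in>S. \<Prod>b<n. reinversion_sign \<sigma> \<tau> a b)"
    by (simp add: prod.subset_diff[OF S finite_lessThan] prod.distrib)
  finally show ?thesis by (simp only: lift_sign_cocycle[OF \<sigma> \<tau>])
qed


section \<open>Isomorphisms of group rings\<close>

text \<open>Both coefficient rings of the theorem have this form, with \<open>S\<close> the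
  generated subring or \<open>UNIV\<close>, so one argument serves both claims.\<close>

abbreviation scalar_ring :: "complex set \<Rightarrow> complex ring" where
  "scalar_ring S \<equiv> \<lparr>carrier = S, mult = (*), one = 1, zero = 0, add = (+)\<rparr>"

lemma subring_complexD:
  assumes "subring S complex_field"
  shows "ring (scalar_ring S)" "0 \<in> S" "1 \<in> S"
    "a \<in> S \<Longrightarrow> b \<in> S \<Longrightarrow> a + b \<in> S" "a \<in> S \<Longrightarrow> b \<in> S \<Longrightarrow> a * b \<in> S" "a \<in> S \<Longrightarrow> - a \<in> S"
proof -
  show "ring (scalar_ring S)"
    using ring.subring_is_ring[OF class_ring.ring_axioms assms] by simp
  show "0 \<in> S" "1 \<in> S" "a \<in> S \<Longrightarrow> b \<in> S \<Longrightarrow> a + b \<in> S" "a \<in> S \<Longrightarrow> b \<in> S \<Longrightarrow> a * b \<in> S"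
    using subringE[OF assms] by auto
  show "a \<in> S \<Longrightarrow> - a \<in> S"
    using subringE(5)[OF assms] by (simp add: class_ring_simps)
qed

lemma sum_in_subring:
  assumes "subring S complex_field" "\<And>x. x \<in> A \<Longrightarrow> f x \<in> S"
  shows "sum f A \<in> S"
  using assms(2)
  by (induction A rule: infinite_finite_induct) (auto intro: subring_complexD[OF assms(1)])

lemma prod_in_subring:
  assumes "subring S complex_field" "\<And>x. x \<in> A \<Longrightarrow> f x \<in> S"
  shows "prod f A \<in> S"
  using assms(2)
  by (induction A rule: infinite_finite_induct) (auto intro: subring_complexD[OF assms(1)])

lemma finsum_scalar_ring:
  assumes "subring S complex_field" "finite A" "\<And>x. x \<in> A \<Longrightarrow> f x \<in> S"
  shows "finsum (scalar_ring S) f A = sum f A"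
proof -
  interpret R: ring "scalar_ring S" by (rule subring_complexD[OF assms(1)])
  show ?thesis
    using assms(2,3)
  proof (induction A)
    case empty
    show ?case using R.finsum_empty[of f] by simp
  next
    case (insert x A)
    then show ?case by (subst R.finsum_insert) auto
  qed
qed

lemma group_ring_scalar_ring:
  assumes "finite (carrier G)"
  shows "carrier (group_ring (scalar_ring S) G) = (carrier G \<rightarrow>\<^sub>E S)"
    and "f \<oplus>\<^bsub>group_ring (scalar_ring S) G\<^esub> h = (\<lambda>x\<in>carrier G. f x + h x)"
    and "\<one>\<^bsub>group_ring (scalar_ring S) G\<^esub> = (\<lambda>x\<in>carrier G. if x = \<one>\<^bsub>G\<^esub> then 1 else 0)"
    and "c \<odot>\<^bsub>group_ring (scalar_ring S) G\<^esub> f = (\<lambda>x\<in>carrier G. c * f x)"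
  using assms by (auto simp: group_ring_def)

text \<open>Over a finite group the convolution may run over all of \<open>G\<close>, since the
  terms outside the support of \<open>f\<close> vanish.\<close>

lemma group_ring_mult:
  assumes S: "subring S complex_field" and G: "group G" "finite (carrier G)"
    and f: "f \<in> carrier G \<rightarrow>\<^sub>E S" and h: "h \<in> carrier G \<rightarrow>\<^sub>E S"
  shows "f \<otimes>\<^bsub>group_ring (scalar_ring S) G\<^esub> h =
    (\<lambda>x\<in>carrier G. \<Sum>y\<in>carrier G. f y * h (inv\<^bsub>G\<^esub> y \<otimes>\<^bsub>G\<^esub> x))"
proof -
  interpret group G by (rule G)
  have "(\<Oplus>\<^bsub>scalar_ring S\<^esub>y\<in>{y \<in> carrier G. f y \<noteq> 0}. f y * h (inv\<^bsub>G\<^esub> y \<otimes>\<^bsub>G\<^esub> x)) =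
      (\<Sum>y\<in>carrier G. f y * h (inv\<^bsub>G\<^esub> y \<otimes>\<^bsub>G\<^esub> x))" if "x \<in> carrier G" for x
  proof -
    have "(\<Oplus>\<^bsub>scalar_ring S\<^esub>y\<in>{y \<in> carrier G. f y \<noteq> 0}. f y * h (inv\<^bsub>G\<^esub> y \<otimes>\<^bsub>G\<^esub> x)) =
        (\<Sum>y\<in>{y \<in> carrier G. f y \<noteq> 0}. f y * h (inv\<^bsub>G\<^esub> y \<otimes>\<^bsub>G\<^esub> x))"
      using G f h that
      by (intro finsum_scalar_ring[OF S]) (auto intro!: subring_complexD(5)[OF S])
    also have "\<dots> = (\<Sum>y\<in>carrier G. f y * h (inv\<^bsub>G\<^esub> y \<otimes>\<^bsub>G\<^esub> x))"
      using G by (intro sum.mono_neutral_left) auto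
    finally show ?thesis .
  qed
  then show ?thesis by (auto simp: group_ring_def intro!: restrict_ext)
qed

text \<open>
  \<open>P h\<close> is the image of the basis element \<open>h\<close> under a linear map of group rings, and \<open>Q\<close> is the
  inverse matrix.
\<close>

lemma group_ring_isomorphic_kernel:
  assumes S: "subring S complex_field"
    and H: "group H" "finite (carrier H)" and G: "group G" "finite (carrier G)"
    and P: "\<And>h x. h \<in> carrier H \<Longrightarrow> x \<in> carrier G \<Longrightarrow> P h x \<in> S"
    and Q: "\<And>x h. x \<in> carrier G \<Longrightarrow> h \<in> carrier H \<Longrightarrow> Q x h \<in> S"
    and mult: "\<And>h k x. h \<in> carrier H \<Longrightarrow> k \<in> carrier H \<Longrightarrow> x \<in> carrier G \<Longrightarrow>
      (\<Sum>y\<in>carrier G. P h y * P k (inv\<^bsub>G\<^esub> y \<otimes>\<^bsub>G\<^esub> x)) = P (h \<otimes>\<^bsub>H\<^esub> k) x"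
    and one: "\<And>x. x \<in> carrier G \<Longrightarrow> P \<one>\<^bsub>H\<^esub> x = (if x = \<one>\<^bsub>G\<^esub> then 1 else 0)"
    and PQ: "\<And>h k. h \<in> carrier H \<Longrightarrow> k \<in> carrier H \<Longrightarrow>
      (\<Sum>x\<in>carrier G. P h x * Q x k) = (if h = k then 1 else 0)"
    and QP: "\<And>x y. x \<in> carrier G \<Longrightarrow> y \<in> carrier G \<Longrightarrow>
      (\<Sum>h\<in>carrier H. Q x h * P h y) = (if x = y then 1 else 0)"
  shows "algebra_isomorphic (scalar_ring S) (group_ring (scalar_ring S) H) (group_ring (scalar_ring S) G)"
proof -
  interpret G: group G by (rule G)
  interpret H: group H by (rule H)
  note S_intros = subring_complexD(2-5)[OF S]
  note [simp] = group_ring_scalar_ring[OF G(2)] group_ring_scalar_ring[OF H(2)]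
  define \<phi> where "\<phi> f = (\<lambda>x\<in>carrier G. \<Sum>h\<in>carrier H. f h * P h x)" for f :: "'a \<Rightarrow> complex"
  define \<psi> where "\<psi> f = (\<lambda>h\<in>carrier H. \<Sum>x\<in>carrier G. f x * Q x h)" for f :: "'c \<Rightarrow> complex"
  have \<phi>_closed: "\<phi> f \<in> carrier G \<rightarrow>\<^sub>E S" if "f \<in> carrier H \<rightarrow>\<^sub>E S" for f
    using that P by (auto simp: \<phi>_def intro!: sum_in_subring[OF S] S_intros)
  have \<psi>_closed: "\<psi> f \<in> carrier H \<rightarrow>\<^sub>E S" if "f \<in> carrier G \<rightarrow>\<^sub>E S" for f
    using that Q by (auto simp: \<psi>_def intro!: sum_in_subring[OF S] S_intros)
  have \<psi>\<phi>: "\<psi> (\<phi> f) = f" if "f \<in> carrier H \<rightarrow>\<^sub>E S" for f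
  proof
    fix k
    show "\<psi> (\<phi> f) k = f k"
    proof (cases "k \<in> carrier H")
      case True
      then have "\<psi> (\<phi> f) k = (\<Sum>x\<in>carrier G. \<Sum>h\<in>carrier H. f h * (P h x * Q x k))"
        by (simp add: \<phi>_def \<psi>_def sum_distrib_right mult.assoc)
      also have "\<dots> = (\<Sum>h\<in>carrier H. f h * (if h = k then 1 else 0))"
        by (subst sum.swap) (simp add: PQ True flip: sum_distrib_left)
      also have "\<dots> = f k" using True H(2) by (simp add: if_distrib cong: if_cong)
      finally show ?thesis .
    qed (use that in \<open>auto simp: \<psi>_def\<close>)
  qed
  have \<phi>\<psi>: "\<phi> (\<psi> f) = f" if "f \<in> carrier G \<rightarrow>\<^sub>E S" for f
  proof
    fix k
    show "\<phi> (\<psi> f) k = f k"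
    proof (cases "k \<in> carrier G")
      case True
      then have "\<phi> (\<psi> f) k = (\<Sum>h\<in>carrier H. \<Sum>x\<in>carrier G. f x * (Q x h * P h k))"
        by (simp add: \<phi>_def \<psi>_def sum_distrib_right mult.assoc)
      also have "\<dots> = (\<Sum>x\<in>carrier G. f x * (if x = k then 1 else 0))"
        by (subst sum.swap) (simp add: QP True flip: sum_distrib_left)
      also have "\<dots> = f k" using True G(2) by (simp add: if_distrib cong: if_cong)
      finally show ?thesis .
    qed (use that in \<open>auto simp: \<phi>_def\<close>)
  qed
  have \<phi>_mult: "\<phi> (f \<otimes>\<^bsub>group_ring (scalar_ring S) H\<^esub> g) = \<phi> f \<otimes>\<^bsub>group_ring (scalar_ring S) G\<^esub> \<phi> g"
    if f: "f \<in> carrier H \<rightarrow>\<^sub>E S" and g: "g \<in> carrier H \<rightarrow>\<^sub>E S" for f g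
  proof -
    have "(\<Sum>h\<in>carrier H. (\<Sum>y\<in>carrier H. f y * g (inv\<^bsub>H\<^esub> y \<otimes>\<^bsub>H\<^esub> h)) * P h x) =
        (\<Sum>z\<in>carrier G. (\<Sum>y\<in>carrier H. f y * P y z) *
          (\<Sum>k\<in>carrier H. g k * P k (inv\<^bsub>G\<^esub> z \<otimes>\<^bsub>G\<^esub> x)))"
      if x: "x \<in> carrier G" for x
    proof -
      have "(\<Sum>h\<in>carrier H. (\<Sum>y\<in>carrier H. f y * g (inv\<^bsub>H\<^esub> y \<otimes>\<^bsub>H\<^esub> h)) * P h x) =
          (\<Sum>y\<in>carrier H. \<Sum>h\<in>carrier H. f y * (g (inv\<^bsub>H\<^esub> y \<otimes>\<^bsub>H\<^esub> h) * P h x))"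
        by (subst sum.swap) (simp add: sum_distrib_right mult.assoc)
      \<comment> \<open>For fixed \<open>y\<close>, the substitution of \<open>y k\<close> for
        \<open>h\<close> turns the convolution into a double sum over products of basis elements, to
        which \<open>mult\<close> applies.\<close>
      also have "\<dots> = (\<Sum>y\<in>carrier H. \<Sum>k\<in>carrier H. f y * (g k * P (y \<otimes>\<^bsub>H\<^esub> k) x))"
      proof (rule sum.cong[OF refl])
        fix y assume y: "y \<in> carrier H"
        show "(\<Sum>h\<in>carrier H. f y * (g (inv\<^bsub>H\<^esub> y \<otimes>\<^bsub>H\<^esub> h) * P h x)) =
            (\<Sum>k\<in>carrier H. f y * (g k * P (y \<otimes>\<^bsub>H\<^esub> k) x))"
          by (rule sum.reindex_bij_witness
              [where i = "\<lambda>k. y \<otimes>\<^bsub>H\<^esub> k" and j = "\<lambda>h. inv\<^bsub>H\<^esub> y \<otimes>\<^bsub>H\<^esub> h"])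
             (use y in \<open>auto simp flip: H.m_assoc\<close>)
      qed
      also have "\<dots> = (\<Sum>y\<in>carrier H. \<Sum>k\<in>carrier H. \<Sum>z\<in>carrier G.
          f y * P y z * (g k * P k (inv\<^bsub>G\<^esub> z \<otimes>\<^bsub>G\<^esub> x)))"
        using x by (intro sum.cong refl)
          (simp add: mult[symmetric] sum_distrib_left mult_ac)
      also have "\<dots> = (\<Sum>y\<in>carrier H. \<Sum>z\<in>carrier G. \<Sum>k\<in>carrier H.
          f y * P y z * (g k * P k (inv\<^bsub>G\<^esub> z \<otimes>\<^bsub>G\<^esub> x)))"
        by (intro sum.cong refl sum.swap)
      also have "\<dots> = (\<Sum>z\<in>carrier G. (\<Sum>y\<in>carrier H. f y * P y z) *
          (\<Sum>k\<in>carrier H. g k * P k (inv\<^bsub>G\<^esub> z \<otimes>\<^bsub>G\<^esub> x)))"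
        by (subst sum.swap) (simp add: sum_product)
      finally show ?thesis .
    qed
    then show ?thesis
      unfolding group_ring_mult[OF S H f g] group_ring_mult[OF S G \<phi>_closed[OF f] \<phi>_closed[OF g]]
      by (auto simp: \<phi>_def intro!: restrict_ext)
  qed
  have "\<phi> \<in> ring_iso (group_ring (scalar_ring S) H) (group_ring (scalar_ring S) G)"
  proof (rule ring_iso_memI)
    show "\<phi> f \<in> carrier (group_ring (scalar_ring S) G)"
      if "f \<in> carrier (group_ring (scalar_ring S) H)" for f
      using \<phi>_closed that by simp
    show "\<phi> (f \<otimes>\<^bsub>group_ring (scalar_ring S) H\<^esub> g) = \<phi> f \<otimes>\<^bsub>group_ring (scalar_ring S) G\<^esub> \<phi> g"
      if "f \<in> carrier (group_ring (scalar_ring S) H)" "g \<in> carrier (group_ring (scalar_ring S) H)" for f g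
      using \<phi>_mult that by simp
    show "\<phi> (f \<oplus>\<^bsub>group_ring (scalar_ring S) H\<^esub> g) = \<phi> f \<oplus>\<^bsub>group_ring (scalar_ring S) G\<^esub> \<phi> g" for f g
      by (auto simp: \<phi>_def distrib_right sum.distrib intro!: restrict_ext)
    show "\<phi> \<one>\<^bsub>group_ring (scalar_ring S) H\<^esub> = \<one>\<^bsub>group_ring (scalar_ring S) G\<^esub>"
    proof -
      have "(\<Sum>h\<in>carrier H. (if h = \<one>\<^bsub>H\<^esub> then 1 else 0) * P h x) = P \<one>\<^bsub>H\<^esub> x" for x
        using H(2) by (simp add: if_distrib if_distribR cong: if_cong)
      then show ?thesis by (auto simp: \<phi>_def one intro!: restrict_ext)
    qed
    show "bij_betw \<phi> (carrier (group_ring (scalar_ring S) H)) (carrier (group_ring (scalar_ring S) G))"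
      using \<phi>_closed \<psi>_closed \<psi>\<phi> \<phi>\<psi> by (intro bij_betw_byWitness[where f' = \<psi>]) auto
  qed
  moreover have "\<phi> (c \<odot>\<^bsub>group_ring (scalar_ring S) H\<^esub> f) = c \<odot>\<^bsub>group_ring (scalar_ring S) G\<^esub> \<phi> f" for c f
    by (auto simp: \<phi>_def sum_distrib_left mult.assoc intro!: restrict_ext)
  ultimately show ?thesis
    unfolding algebra_isomorphic_def algebra_iso_def by blast
qed

text \<open>The kernel is the permutation matrix of \<theta>, and the inverse kernel is its
  transpose.\<close>

lemma group_ring_isomorphic_iso:
  assumes S: "subring S complex_field" and H: "group H" "finite (carrier H)" and G: "group G"
    and \<theta>: "\<theta> \<in> Group.iso H G"
  shows "algebra_isomorphic (scalar_ring S) (group_ring (scalar_ring S) H) (group_ring (scalar_ring S) G)"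
proof -
  interpret G: group G by (rule G)
  interpret H: group H by (rule H)
  have bij: "bij_betw \<theta> (carrier H) (carrier G)" and hom: "\<theta> \<in> hom H G"
    using \<theta> by (auto simp: Group.iso_def)
  have fin: "finite (carrier G)" using bij_betw_finite[OF bij] H by simp
  have closed: "\<theta> h \<in> carrier G" if "h \<in> carrier H" for h
    using hom that by (simp add: hom_in_carrier)
  have inj: "\<theta> h = \<theta> k \<longleftrightarrow> h = k" if "h \<in> carrier H" "k \<in> carrier H" for h k
    using bij that by (auto simp: bij_betw_def dest: inj_onD)
  show ?thesis
  proof (rule group_ring_isomorphic_kernel[OF S H G fin,
        where P = "\<lambda>h x. if x = \<theta> h then 1 else 0" and Q = "\<lambda>x h. if x = \<theta> h then 1 else 0"])
    fix h k x assume hk: "h \<in> carrier H" "k \<in> carrier H" and x: "x \<in> carrier G"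
    have "(\<Sum>y\<in>carrier G. (if y = \<theta> h then 1 else 0) * (if inv\<^bsub>G\<^esub> y \<otimes>\<^bsub>G\<^esub> x = \<theta> k then 1 else 0 :: complex))
        = (if inv\<^bsub>G\<^esub> (\<theta> h) \<otimes>\<^bsub>G\<^esub> x = \<theta> k then 1 else 0)"
      using fin closed hk
      by (subst sum.mono_neutral_right[where S = "{\<theta> h}"]) auto
    also have "inv\<^bsub>G\<^esub> (\<theta> h) \<otimes>\<^bsub>G\<^esub> x = \<theta> k \<longleftrightarrow> x = \<theta> (h \<otimes>\<^bsub>H\<^esub> k)"
      using hk x closed by (simp add: G.inv_solve_left' hom_mult[OF hom])
    finally show "(\<Sum>y\<in>carrier G. (if y = \<theta> h then 1 else 0) *
        (if inv\<^bsub>G\<^esub> y \<otimes>\<^bsub>G\<^esub> x = \<theta> k then 1 else 0 :: complex)) = (if x = \<theta> (h \<otimes>\<^bsub>H\<^esub> k) then 1 else 0)" .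
  next
    fix h k assume "h \<in> carrier H" "k \<in> carrier H"
    then show "(\<Sum>x\<in>carrier G. (if x = \<theta> h then 1 else 0) * (if x = \<theta> k then 1 else 0)) =
        (if h = k then 1 else 0 :: complex)"
      using fin closed inj by (subst sum.mono_neutral_right[where S = "{\<theta> h}"]) auto
  next
    fix x y assume "x \<in> carrier G" "y \<in> carrier G"
    then obtain h where h: "h \<in> carrier H" "x = \<theta> h" using bij by (auto simp: bij_betw_def)
    have "(\<Sum>k\<in>carrier H. (if x = \<theta> k then 1 else 0) * (if y = \<theta> k then 1 else 0 :: complex)) =
        (\<Sum>k\<in>carrier H. if k = h then (if y = \<theta> k then 1 else 0) else 0)"
      using h by (intro sum.cong refl) (auto simp: inj)
    also have "\<dots> = (if x = y then 1 else 0)" using H h by auto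
    finally show "(\<Sum>k\<in>carrier H. (if x = \<theta> k then 1 else 0) * (if y = \<theta> k then 1 else 0 :: complex)) =
        (if x = y then 1 else 0)" .
  qed (use S in \<open>auto simp: subring_complexD hom_one[OF hom H(1) G]\<close>)
qed

lemma algebra_isomorphic_trans:
  assumes "algebra_isomorphic R A B" "algebra_isomorphic R B D"
  shows "algebra_isomorphic R A D"
proof -
  obtain f g where f: "f \<in> algebra_iso R A B" and g: "g \<in> algebra_iso R B D"
    using assms by (auto simp: algebra_isomorphic_def)
  have "g \<circ> f \<in> ring_iso A D"
    using f g by (auto simp: algebra_iso_def intro: ring_iso_set_trans)
  moreover have "f x \<in> carrier B" if "x \<in> carrier A" for x
    using f that by (auto simp: algebra_iso_def dest: ring_iso_memE)
  ultimately have "g \<circ> f \<in> algebra_iso R A D"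
    using f g by (auto simp: algebra_iso_def)
  then show ?thesis by (auto simp: algebra_isomorphic_def)
qed


section \<open>Fourier coefficients on sign vectors\<close>

definition sign_vectors :: "nat \<Rightarrow> (nat \<Rightarrow> complex) set" where
  "sign_vectors n = {..<n} \<rightarrow>\<^sub>E {1, -1}"

text \<open>This is the coefficient at \<open>a\<close> of the element of the group ring of sign
  vectors whose value at the character of \<open>S\<close> is \<open>u S\<close>. The extension by 0
  lets a quotient of diagonal entries be inserted before its entries are known to be signs.\<close>

definition fourier_coeff :: "nat \<Rightarrow> (nat set \<Rightarrow> complex) \<Rightarrow> (nat \<Rightarrow> complex) \<Rightarrow> complex" where
  "fourier_coeff n u a =
     (if \<forall>j<n. a j \<in> {1, -1} then (\<Sum>S\<in>Pow {..<n}. (\<Prod>j\<in>S. a j) * u S) / 2 ^ n else 0)"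

lemma finite_sign_vectors [simp]: "finite (sign_vectors n)"
  by (simp add: sign_vectors_def finite_PiE)

lemma sign_vectorsD: "a \<in> sign_vectors n \<Longrightarrow> j < n \<Longrightarrow> a j = 1 \<or> a j = -1"
  by (auto simp: sign_vectors_def)

lemma fourier_coeff_cong:
  assumes "\<And>S. S \<subseteq> {..<n} \<Longrightarrow> u S = v S" and "\<And>j. j < n \<Longrightarrow> a j = b j"
  shows "fourier_coeff n u a = fourier_coeff n v b"
proof -
  have "(\<Sum>S\<in>Pow {..<n}. (\<Prod>j\<in>S. a j) * u S) = (\<Sum>S\<in>Pow {..<n}. (\<Prod>j\<in>S. b j) * v S)"
    using assms by (intro sum.cong refl arg_cong2[of _ _ _ _ "(*)"] prod.cong) auto
  moreover have "(\<forall>j<n. a j \<in> {1, -1}) \<longleftrightarrow> (\<forall>j<n. b j \<in> {1, -1})" using assms by simp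
  ultimately show ?thesis by (simp only: fourier_coeff_def)
qed

text \<open>The sum factors over the coordinates. The factor at \<open>j\<close> is 2 if
  \<open>j\<close> lies in both sets or in neither, and 1 + (-1) = 0 otherwise.\<close>

lemma sum_sign_vectors_orthogonal:
  assumes "S \<subseteq> {..<n}" "S' \<subseteq> {..<n}"
  shows "(\<Sum>a\<in>sign_vectors n. (\<Prod>j\<in>S. a j) * (\<Prod>j\<in>S'. a j)) = (if S = S' then 2 ^ n else 0)"
proof -
  let ?f = "\<lambda>j x. (if j \<in> S then x else 1) * (if j \<in> S' then x else 1) :: complex"
  have restrict: "(\<Prod>j\<in>B. a j) = (\<Prod>j<n. if j \<in> B then a j else 1)" if "B \<subseteq> {..<n}" for B and a :: "nat \<Rightarrow> complex"
    using that by (simp add: prod.If_cases Int_absorb1)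
  have "(\<Sum>a\<in>sign_vectors n. (\<Prod>j\<in>S. a j) * (\<Prod>j\<in>S'. a j)) = (\<Sum>a\<in>sign_vectors n. \<Prod>j<n. ?f j (a j))"
    unfolding restrict[OF assms(1)] restrict[OF assms(2)] by (simp only: prod.distrib)
  also have "\<dots> = (\<Prod>j<n. \<Sum>x\<in>{1, -1}. ?f j x)"
    unfolding sign_vectors_def by (rule prod_sum_PiE[symmetric]) auto
  also have "\<dots> = (\<Prod>j<n. if j \<in> S \<longleftrightarrow> j \<in> S' then 2 else 0)"
    by (intro prod.cong) auto
  also have "\<dots> = (if S = S' then 2 ^ n else 0)"
    using assms by auto
  finally show ?thesis .
qed

lemma fourier_inversion:
  assumes "S \<subseteq> {..<n}"
  shows "(\<Sum>a\<in>sign_vectors n. fourier_coeff n u a * (\<Prod>j\<in>S. a j)) = u S"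
proof -
  have "(\<Sum>a\<in>sign_vectors n. fourier_coeff n u a * (\<Prod>j\<in>S. a j)) =
      (\<Sum>a\<in>sign_vectors n. \<Sum>S'\<in>Pow {..<n}. u S' * ((\<Prod>j\<in>S'. a j) * (\<Prod>j\<in>S. a j)) / 2 ^ n)"
    by (intro sum.cong refl)
      (use sign_vectorsD in \<open>simp add: fourier_coeff_def sum_divide_distrib sum_distrib_left mult_ac\<close>)
  also have "\<dots> = (\<Sum>S'\<in>Pow {..<n}. u S' * (if S' = S then 2 ^ n else 0) / 2 ^ n)"
    using assms
    by (subst sum.swap, intro sum.cong refl)
      (simp only: sum_sign_vectors_orthogonal Pow_iff flip: sum_divide_distrib sum_distrib_left)
  also have "\<dots> = (\<Sum>S'\<in>Pow {..<n}. if S' = S then u S' else 0)"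
    by (intro sum.cong) auto
  also have "\<dots> = u S" using assms by simp
  finally show ?thesis .
qed

lemma fourier_coeff_convolution:
  assumes \<tau>: "\<tau> permutes {..<n}"
  shows "(\<Sum>a\<in>sign_vectors n. fourier_coeff n u a * fourier_coeff n v (\<lambda>j. X j * a (\<tau> j))) =
    fourier_coeff n (\<lambda>S. u (\<tau> ` S) * v S) X"
proof (cases "\<forall>j<n. X j \<in> {1, -1}")
  case True
  have \<tau>n: "\<tau> j < n" if "j < n" for j using permutes_in_image[OF \<tau>, of j] that by simp
  have inj: "inj \<tau>" by (rule permutes_inj[OF \<tau>])
  have "(\<Sum>a\<in>sign_vectors n. fourier_coeff n u a * fourier_coeff n v (\<lambda>j. X j * a (\<tau> j))) =
      (\<Sum>a\<in>sign_vectors n. \<Sum>S\<in>Pow {..<n}.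
        (\<Prod>j\<in>S. X j) * v S / 2 ^ n * (fourier_coeff n u a * (\<Prod>j\<in>\<tau> ` S. a j)))"
  proof (intro sum.cong refl)
    fix a assume a: "a \<in> sign_vectors n"
    have "\<forall>j<n. X j * a (\<tau> j) \<in> {1, -1}"
      using True sign_vectorsD[OF a \<tau>n] by fastforce
    then show "fourier_coeff n u a * fourier_coeff n v (\<lambda>j. X j * a (\<tau> j)) =
        (\<Sum>S\<in>Pow {..<n}. (\<Prod>j\<in>S. X j) * v S / 2 ^ n * (fourier_coeff n u a * (\<Prod>j\<in>\<tau> ` S. a j)))"
      unfolding fourier_coeff_def[of n v]
      by (simp add: prod.reindex[OF inj_on_subset[OF inj]] prod.distrib sum_divide_distrib
          sum_distrib_left mult_ac)
  qed
  also have "\<dots> = (\<Sum>S\<in>Pow {..<n}. (\<Prod>j\<in>S. X j) * v S / 2 ^ n * u (\<tau> ` S))"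
  proof (subst sum.swap, intro sum.cong refl)
    fix S assume "S \<in> Pow {..<n}"
    then have "\<tau> ` S \<subseteq> {..<n}" using \<tau>n by auto
    then show "(\<Sum>a\<in>sign_vectors n. (\<Prod>j\<in>S. X j) * v S / 2 ^ n * (fourier_coeff n u a * (\<Prod>j\<in>\<tau> ` S. a j))) =
        (\<Prod>j\<in>S. X j) * v S / 2 ^ n * u (\<tau> ` S)"
      by (simp only: fourier_inversion flip: sum_distrib_left)
  qed
  also have "\<dots> = fourier_coeff n (\<lambda>S. u (\<tau> ` S) * v S) X"
    using True by (simp add: fourier_coeff_def sum_divide_distrib mult_ac)
  finally show ?thesis .
next
  case False
  then obtain j where j: "j < n" "X j \<notin> {1, -1}" by blast
  have "fourier_coeff n v (\<lambda>j. X j * a (\<tau> j)) = 0" if "a \<in> sign_vectors n" for a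
  proof -
    have "\<tau> j < n" using permutes_in_image[OF \<tau>, of j] j by simp
    then have "X j * a (\<tau> j) \<notin> {1, -1}"
      using j sign_vectorsD[OF that, of "\<tau> j"] by (auto simp: minus_equation_iff)
    then show ?thesis using j(1) by (auto simp: fourier_coeff_def)
  qed
  then have "(\<Sum>a\<in>sign_vectors n. fourier_coeff n u a * fourier_coeff n v (\<lambda>j. X j * a (\<tau> j))) = 0"
    by simp
  then show ?thesis using False by (simp only: fourier_coeff_def[of n _ X] if_False)
qed

text \<open>Multiplying each value by the character's value at \<delta> translates the element by
  \<delta>.\<close>

lemma fourier_coeff_mult_character:
  assumes "\<And>j. j < n \<Longrightarrow> \<delta> j \<in> {1, -1}"
  shows "fourier_coeff n (\<lambda>S. u S * (\<Prod>j\<in>S. \<delta> j)) X = fourier_coeff n u (\<lambda>j. X j * \<delta> j)"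
proof -
  have "(\<forall>j<n. X j \<in> {1, -1}) \<longleftrightarrow> (\<forall>j<n. X j * \<delta> j \<in> {1, -1})"
    using assms by (fastforce simp: minus_equation_iff)
  then show ?thesis by (simp only: fourier_coeff_def prod.distrib mult_ac)
qed

text \<open>The sum over subsets expands the product of the factors \<open>a j + 1\<close>, which
  vanishes as soon as some entry is -1.\<close>

lemma fourier_coeff_one:
  "fourier_coeff n (\<lambda>S. 1) a = (if \<forall>j<n. a j = 1 then 1 else 0)"
proof (cases "\<forall>j<n. a j \<in> {1, -1}")
  case True
  have "(\<Sum>S\<in>Pow {..<n}. \<Prod>j\<in>S. a j) = (\<Prod>j<n. a j + 1)"
    by (simp add: prod_add)
  also have "\<dots> = (if \<forall>j<n. a j = 1 then 2 ^ n else 0)"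
  proof (cases "\<forall>j<n. a j = 1")
    case False
    then obtain j where "j < n" "a j + 1 = 0" using True by fastforce
    then show ?thesis using False by (auto intro!: prod_zero)
  qed simp
  finally show ?thesis using True by (simp add: fourier_coeff_def)
qed (auto simp: fourier_coeff_def)

text \<open>When the entries of \<open>a\<close> have product -1, replacing \<open>S\<close> by its
  complement negates the character and keeps \<open>u\<close>, so the sum equals its own
  negative.\<close>

lemma fourier_coeff_eq_0:
  assumes u: "\<And>S. S \<subseteq> {..<n} \<Longrightarrow> u ({..<n} - S) = u S" and a: "(\<Prod>j<n. a j) \<noteq> 1"
  shows "fourier_coeff n u a = 0"
proof (cases "\<forall>j<n. a j \<in> {1, -1}")
  case True
  have "(\<Prod>j<n. a j) * (\<Prod>j<n. a j) = 1"
    unfolding prod.distrib[symmetric] using True by (intro prod.neutral) auto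
  with a have a: "(\<Prod>j<n. a j) = -1" by (metis square_eq_1_iff)
  let ?t = "\<Sum>S\<in>Pow {..<n}. (\<Prod>j\<in>S. a j) * u S"
  have "?t = (\<Sum>S\<in>Pow {..<n}. (\<Prod>j\<in>{..<n} - S. a j) * u ({..<n} - S))"
    by (rule sum.reindex_bij_witness[where i = "\<lambda>S. {..<n} - S" and j = "\<lambda>S. {..<n} - S"])
       (simp_all add: double_diff Pow_def)
  also have "\<dots> = (\<Sum>S\<in>Pow {..<n}. - ((\<Prod>j\<in>S. a j) * u S))"
  proof (intro sum.cong refl)
    fix S assume S: "S \<in> Pow {..<n}"
    have "(\<Prod>j\<in>S. a j) * (\<Prod>j\<in>S. a j) = 1"
      unfolding prod.distrib[symmetric] using True S by (intro prod.neutral) auto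
    moreover have "(\<Prod>j\<in>{..<n} - S. a j) * (\<Prod>j\<in>S. a j) = -1"
      using prod.subset_diff[of S "{..<n}" a] S a by simp
    ultimately have "(\<Prod>j\<in>{..<n} - S. a j) = - (\<Prod>j\<in>S. a j)"
      by (metis mult.assoc mult.commute mult.right_neutral mult_minus1)
    then show "(\<Prod>j\<in>{..<n} - S. a j) * u ({..<n} - S) = - ((\<Prod>j\<in>S. a j) * u S)"
      using u S by simp
  qed
  finally have "?t = 0" by (simp add: sum_negf)
  then show ?thesis by (simp add: fourier_coeff_def)
qed (auto simp: fourier_coeff_def)

lemma fourier_coeff_in_subring:
  assumes R: "subring R complex_field" and "1 / 2 \<in> R" and "\<And>S. S \<subseteq> {..<n} \<Longrightarrow> u S \<in> R"
  shows "fourier_coeff n u a \<in> R"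
proof -
  note intros = subring_complexD(2-6)[OF R] sum_in_subring[OF R] prod_in_subring[OF R]
  have "(1 / 2) ^ k \<in> R" for k :: nat
    using assms(2) by (induction k) (simp_all only: power_0 power_Suc intros)
  moreover have "(\<Sum>S\<in>Pow {..<n}. (\<Prod>j\<in>S. a j) * u S) \<in> R" if "\<forall>j<n. a j \<in> {1, -1}"
    using assms that by (intro intros) (auto intro!: intros)
  ultimately have "(\<Sum>S\<in>Pow {..<n}. (\<Prod>j\<in>S. a j) * u S) * (1 / 2) ^ n \<in> R" if "\<forall>j<n. a j \<in> {1, -1}"
    using that by (intro subring_complexD(5)[OF R])
  then show ?thesis by (auto simp: fourier_coeff_def power_divide intro: intros)
qed


section \<open>The twist of monomial groups\<close>

text \<open>The pair \<open>(\<sigma>, d)\<close> stands for the permutation matrix of \<open>\<sigma>\<close> times the diagonal matrix of \<open>d\<close>.\<close>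

definition monomial_pairs ::
  "((nat \<Rightarrow> nat) \<Rightarrow> complex) \<Rightarrow> complex set \<Rightarrow> complex set \<Rightarrow> nat \<Rightarrow> ((nat \<Rightarrow> nat) \<times> (nat \<Rightarrow> complex)) monoid"
  where
  "monomial_pairs s C C' n = \<lparr>
     carrier = {(\<sigma>, d). \<sigma> permutes {..<n} \<and> d \<in> {..<n} \<rightarrow>\<^sub>E C \<and> s \<sigma> * (\<Prod>j<n. d j) \<in> C'},
     mult = (\<lambda>(\<sigma>, d) (\<tau>, e). (\<sigma> \<circ> \<tau>, \<lambda>j\<in>{..<n}. d (\<tau> j) * e j)),
     one = (id, \<lambda>j\<in>{..<n}. 1)\<rparr>"

text \<open>The two instances are the trivial character, for which \<open>monomial_pairs\<close>
  describes G(m,p,n), and the sign, for which it describes the mystic group.\<close>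

definition sign_character :: "nat \<Rightarrow> ((nat \<Rightarrow> nat) \<Rightarrow> complex) \<Rightarrow> bool" where
  "sign_character n s \<longleftrightarrow> s id = 1 \<and>
     (\<forall>\<sigma> \<tau>. \<sigma> permutes {..<n} \<longrightarrow> \<tau> permutes {..<n} \<longrightarrow> s (\<sigma> \<circ> \<tau>) = s \<sigma> * s \<tau>) \<and>
     (\<forall>\<sigma>. s \<sigma> * s \<sigma> = 1)"

definition mult_closed_units :: "complex set \<Rightarrow> bool" where
  "mult_closed_units C \<longleftrightarrow> 1 \<in> C \<and> 0 \<notin> C \<and> (\<forall>x\<in>C. \<forall>y\<in>C. x * y \<in> C) \<and> (\<forall>x\<in>C. inverse x \<in> C)"

text \<open>For \<open>z = \<i>\<close> this is the coefficient at the second pair of the image of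
  the first: the lift of \<sigma>, times the diagonal matrix of \<open>d\<close>, times the twisting
  unit of \<sigma>. For \<open>z = -\<i>\<close> it is the kernel of the inverse map, as the lift
  signs are their own inverses.\<close>

definition twist_kernel ::
  "complex \<Rightarrow> nat \<Rightarrow> (nat \<Rightarrow> nat) \<times> (nat \<Rightarrow> complex) \<Rightarrow> (nat \<Rightarrow> nat) \<times> (nat \<Rightarrow> complex) \<Rightarrow> complex" where
  "twist_kernel z n = (\<lambda>(\<sigma>, d) (\<tau>, e).
     if \<sigma> = \<tau> then fourier_coeff n (split_weight z n \<sigma>) (\<lambda>j. e j / (d j * lift_sign n \<sigma> j)) else 0)"

section \<open>The groups of pairs\<close>

locale monomial_pair_data =
  fixes C C' :: "complex set" and n :: nat
  assumes C: "mult_closed_units C" and C': "mult_closed_units C'" and finite_C: "finite C"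
begin

lemma C_closed: "1 \<in> C" "x \<in> C \<Longrightarrow> x \<noteq> 0" "x \<in> C \<Longrightarrow> y \<in> C \<Longrightarrow> x * y \<in> C" "x \<in> C \<Longrightarrow> inverse x \<in> C"
  using C by (auto simp: mult_closed_units_def)

lemma C'_closed: "1 \<in> C'" "x \<in> C' \<Longrightarrow> x \<noteq> 0" "x \<in> C' \<Longrightarrow> y \<in> C' \<Longrightarrow> x * y \<in> C'" "x \<in> C' \<Longrightarrow> inverse x \<in> C'"
  using C' by (auto simp: mult_closed_units_def)

abbreviation "\<Gamma> s \<equiv> monomial_pairs s C C' n"

lemma finite_carrier: "finite (carrier (\<Gamma> s))"
proof (rule finite_subset)
  show "carrier (\<Gamma> s) \<subseteq> {\<sigma>. \<sigma> permutes {..<n}} \<times> ({..<n} \<rightarrow>\<^sub>E C)"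
    by (auto simp: monomial_pairs_def)
  show "finite ({\<sigma>. \<sigma> permutes {..<n}} \<times> ({..<n} \<rightarrow>\<^sub>E C))"
    by (intro finite_cartesian_product finite_permutations finite_PiE finite_C) auto
qed

definition pair_inv :: "(nat \<Rightarrow> nat) \<times> (nat \<Rightarrow> complex) \<Rightarrow> (nat \<Rightarrow> nat) \<times> (nat \<Rightarrow> complex)" where
  "pair_inv = (\<lambda>(\<sigma>, d). (inv_into UNIV \<sigma>, \<lambda>j\<in>{..<n}. inverse (d (inv_into UNIV \<sigma> j))))"

lemma pair_mult_closed:
  assumes s: "sign_character n s" and x: "x \<in> carrier (\<Gamma> s)" and y: "y \<in> carrier (\<Gamma> s)"
  shows "x \<otimes>\<^bsub>\<Gamma> s\<^esub> y \<in> carrier (\<Gamma> s)"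
proof -
  obtain \<sigma> d \<tau> e where xy: "x = (\<sigma>, d)" "y = (\<tau>, e)" by (metis prod.exhaust)
  have perm: "\<sigma> permutes {..<n}" "\<tau> permutes {..<n}" and de: "d \<in> {..<n} \<rightarrow>\<^sub>E C" "e \<in> {..<n} \<rightarrow>\<^sub>E C"
    and C': "s \<sigma> * (\<Prod>j<n. d j) \<in> C'" "s \<tau> * (\<Prod>j<n. e j) \<in> C'"
    using x y by (auto simp: xy monomial_pairs_def)
  have "\<tau> j < n" if "j < n" for j using permutes_less[OF perm(2) that] .
  then have "(\<lambda>j\<in>{..<n}. d (\<tau> j) * e j) \<in> {..<n} \<rightarrow>\<^sub>E C"
    using de by (auto intro!: C_closed)
  moreover have "(\<Prod>j<n. d (\<tau> j)) = (\<Prod>j<n. d j)"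
    by (rule prod.reindex_bij_betw[OF permutes_imp_bij[OF perm(2)]])
  then have "s (\<sigma> \<circ> \<tau>) * (\<Prod>j<n. d (\<tau> j) * e j) = (s \<sigma> * (\<Prod>j<n. d j)) * (s \<tau> * (\<Prod>j<n. e j))"
    using s perm by (simp add: sign_character_def prod.distrib)
  then have "s (\<sigma> \<circ> \<tau>) * (\<Prod>j<n. d (\<tau> j) * e j) \<in> C'" using C'_closed(3)[OF C'] by (simp only:)
  ultimately show ?thesis
    using perm by (simp add: xy monomial_pairs_def permutes_compose)
qed

lemma pair_inv_closed:
  assumes s: "sign_character n s" and x: "x \<in> carrier (\<Gamma> s)"
  shows "pair_inv x \<in> carrier (\<Gamma> s)"
proof -
  obtain \<sigma> d where x_eq: "x = (\<sigma>, d)" by (metis prod.exhaust)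
  have perm: "\<sigma> permutes {..<n}" and d: "d \<in> {..<n} \<rightarrow>\<^sub>E C" and C': "s \<sigma> * (\<Prod>j<n. d j) \<in> C'"
    using x by (auto simp: x_eq monomial_pairs_def)
  let ?i = "inv_into UNIV \<sigma>"
  have i: "?i permutes {..<n}" by (rule permutes_inv[OF perm])
  have "s (?i \<circ> \<sigma>) = 1" using s by (simp add: permutes_inv_o[OF perm] sign_character_def)
  then have "s ?i * s \<sigma> = 1" using s i perm by (simp add: sign_character_def del: comp_apply)
  then have si: "s ?i = inverse (s \<sigma>)" by (metis inverse_unique mult.commute)
  have "?i j < n" if "j < n" for j using permutes_less[OF i that] .
  then have "(\<lambda>j\<in>{..<n}. inverse (d (?i j))) \<in> {..<n} \<rightarrow>\<^sub>E C"
    using d by (auto intro!: C_closed)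
  moreover have "(\<Prod>j<n. inverse (d (?i j))) = (\<Prod>j<n. inverse (d j))"
    by (rule prod.reindex_bij_betw[OF permutes_imp_bij[OF i]])
  then have "s ?i * (\<Prod>j<n. inverse (d (?i j))) = inverse (s \<sigma> * (\<Prod>j<n. d j))"
    by (simp add: si prod_inversef[of d, unfolded comp_def])
  then have "s ?i * (\<Prod>j<n. inverse (d (?i j))) \<in> C'" using C'_closed(4)[OF C'] by simp
  ultimately show ?thesis
    using i by (simp add: x_eq monomial_pairs_def pair_inv_def)
qed

lemma pair_inv_mult_left:
  assumes "x \<in> carrier (\<Gamma> s)"
  shows "pair_inv x \<otimes>\<^bsub>\<Gamma> s\<^esub> x = \<one>\<^bsub>\<Gamma> s\<^esub>"
proof -
  obtain \<sigma> d where x_eq: "x = (\<sigma>, d)" by (metis prod.exhaust)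
  have perm: "\<sigma> permutes {..<n}" and d: "d \<in> {..<n} \<rightarrow>\<^sub>E C"
    using assms by (auto simp: x_eq monomial_pairs_def)
  have "\<sigma> j < n" if "j < n" for j using permutes_less[OF perm that] .
  moreover have "d j \<noteq> 0" if "j < n" for j using d that by (intro C_closed(2)) auto
  ultimately show ?thesis
    by (auto simp: x_eq monomial_pairs_def pair_inv_def permutes_inv_o[OF perm]
        permutes_inverses[OF perm] intro!: restrict_ext)
qed

lemma group_pairs:
  assumes s: "sign_character n s"
  shows "group (\<Gamma> s)"
proof (rule groupI)
  show "\<one>\<^bsub>\<Gamma> s\<^esub> \<in> carrier (\<Gamma> s)"
    using s by (auto simp: monomial_pairs_def sign_character_def permutes_id C_closed C'_closed)
  show "x \<otimes>\<^bsub>\<Gamma> s\<^esub> y \<otimes>\<^bsub>\<Gamma> s\<^esub> z = x \<otimes>\<^bsub>\<Gamma> s\<^esub> (y \<otimes>\<^bsub>\<Gamma> s\<^esub> z)"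
    if "x \<in> carrier (\<Gamma> s)" "y \<in> carrier (\<Gamma> s)" "z \<in> carrier (\<Gamma> s)" for x y z
  proof -
    obtain \<sigma> d \<tau> e \<rho> f where xyz: "x = (\<sigma>, d)" "y = (\<tau>, e)" "z = (\<rho>, f)" by (metis prod.exhaust)
    have "\<rho> permutes {..<n}" using that by (simp add: xyz monomial_pairs_def)
    from permutes_less[OF this] show ?thesis
      by (simp add: xyz monomial_pairs_def o_assoc mult.assoc cong: restrict_cong)
  qed
  show "\<one>\<^bsub>\<Gamma> s\<^esub> \<otimes>\<^bsub>\<Gamma> s\<^esub> x = x" if "x \<in> carrier (\<Gamma> s)" for x
  proof -
    obtain \<sigma> d where x: "x = (\<sigma>, d)" by (metis prod.exhaust)
    have \<sigma>: "\<sigma> permutes {..<n}" and d: "d \<in> {..<n} \<rightarrow>\<^sub>E C"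
      using that by (auto simp: x monomial_pairs_def)
    have "(\<lambda>j\<in>{..<n}. d j) = d" using d by (simp add: PiE_restrict flip: restrict_def)
    then show ?thesis
      using permutes_less[OF \<sigma>] by (simp add: x monomial_pairs_def cong: restrict_cong)
  qed
  show "\<exists>y\<in>carrier (\<Gamma> s). y \<otimes>\<^bsub>\<Gamma> s\<^esub> x = \<one>\<^bsub>\<Gamma> s\<^esub>" if "x \<in> carrier (\<Gamma> s)" for x
    using pair_inv_closed[OF s that] pair_inv_mult_left[OF that] by blast
qed (use pair_mult_closed[OF s] in auto)

lemma inv_pairs:
  assumes "sign_character n s" "x \<in> carrier (\<Gamma> s)"
  shows "inv\<^bsub>\<Gamma> s\<^esub> x = pair_inv x"
  using assms
  by (intro group.inv_equality[OF group_pairs] pair_inv_mult_left pair_inv_closed)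

end

text \<open>The product of \<open>s\<close> and \<open>s'\<close> is the sign because the lift signs
  of \<sigma> multiply to its sign; -1 in \<open>C\<close> makes sign changes of the diagonal
  entries possible. The conditions are symmetric in \<open>s\<close> and \<open>s'\<close>, so the
  inverse map falls under the same locale.\<close>

locale twisted_pairs = monomial_pair_data +
  fixes s s' :: "(nat \<Rightarrow> nat) \<Rightarrow> complex"
  assumes s: "sign_character n s" and s': "sign_character n s'"
    and s_s': "\<And>\<sigma>. \<sigma> permutes {..<n} \<Longrightarrow> s \<sigma> * s' \<sigma> = of_int (sign \<sigma>)"
    and minus_1: "-1 \<in> C"
begin

text \<open>The image of a pair is supported on its translates by sign vectors with product 1, and
  these lie in the target group. The other sign vectors have coefficient 0, so they may be included
  even where \<open>F\<close> is evaluated outside the group. The sum then has no determinant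
  condition left and is open to Fourier inversion.\<close>

lemma sum_twist_kernel:
  assumes h: "(\<sigma>, d) \<in> carrier (\<Gamma> s)"
  shows "(\<Sum>y\<in>carrier (\<Gamma> s'). twist_kernel z n (\<sigma>, d) y * F y) =
    (\<Sum>a\<in>sign_vectors n. fourier_coeff n (split_weight z n \<sigma>) a *
       F (\<sigma>, \<lambda>j\<in>{..<n}. d j * lift_sign n \<sigma> j * a j))"
proof -
  let ?T = "{a \<in> sign_vectors n. (\<Prod>j<n. a j) = 1}"
  let ?c = "fourier_coeff n (split_weight z n \<sigma>)"
  let ?g = "\<lambda>a. (\<sigma>, \<lambda>j\<in>{..<n}. d j * lift_sign n \<sigma> j * a j)"
  have \<sigma>: "\<sigma> permutes {..<n}" and d: "d \<in> {..<n} \<rightarrow>\<^sub>E C" and C': "s \<sigma> * (\<Prod>j<n. d j) \<in> C'"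
    using h by (auto simp: monomial_pairs_def)
  have d0: "d j \<noteq> 0" if "j < n" for j using d that by (intro C_closed(2)) auto
  have c0: "?c a = 0" if "(\<Prod>j<n. a j) \<noteq> 1" for a
    using that by (intro fourier_coeff_eq_0 split_weight_compl permutes_inj[OF \<sigma>])
  have kernel_g: "twist_kernel z n (\<sigma>, d) (?g a) = ?c a" for a
    unfolding twist_kernel_def by (auto intro!: fourier_coeff_cong simp: d0)
  have g_inj: "inj_on ?g ?T"
  proof (rule inj_onI)
    fix a b assume ab: "a \<in> ?T" "b \<in> ?T" "?g a = ?g b"
    then have eq: "(\<lambda>j\<in>{..<n}. d j * lift_sign n \<sigma> j * a j) = (\<lambda>j\<in>{..<n}. d j * lift_sign n \<sigma> j * b j)"
      by simp
    have "a j = b j" if "j \<in> {..<n}" for j using fun_cong[OF eq, of j] d0 that by simp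
    then show "a = b" using ab by (intro PiE_ext) (auto simp: sign_vectors_def)
  qed
  have g_closed: "?g a \<in> carrier (\<Gamma> s')" if "a \<in> ?T" for a
  proof -
    have C_eps: "lift_sign n \<sigma> j \<in> C" "j < n \<Longrightarrow> a j \<in> C" for j
      using lift_sign_cases[of n \<sigma> j] sign_vectorsD[of a n j] that minus_1 C_closed(1) by auto
    \<comment> \<open>The lift signs contribute the sign of \<sigma>, which is the product of
      \<open>s \<sigma>\<close> and \<open>s' \<sigma>\<close>; the square of
      \<open>s' \<sigma>\<close> is 1, so the condition for \<open>s'\<close> is the given one for
      \<open>s\<close>.\<close>
    have "s' \<sigma> * (\<Prod>j<n. d j * lift_sign n \<sigma> j * a j) = s' \<sigma> * of_int (sign \<sigma>) * (\<Prod>j<n. d j)"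
      using that by (simp add: prod.distrib prod_lift_sign[OF \<sigma>])
    also have "\<dots> = (s' \<sigma> * s' \<sigma>) * (s \<sigma> * (\<Prod>j<n. d j))"
      by (simp add: s_s'[OF \<sigma>, symmetric])
    also have "\<dots> = s \<sigma> * (\<Prod>j<n. d j)"
      using s' by (simp only: sign_character_def mult_1)
    finally have "s' \<sigma> * (\<Prod>j<n. d j * lift_sign n \<sigma> j * a j) \<in> C'" using C' by (simp only:)
    then show ?thesis
      using \<sigma> d C_eps by (auto simp: monomial_pairs_def intro!: C_closed)
  qed
  have outside: "twist_kernel z n (\<sigma>, d) y = 0" if y: "y \<in> carrier (\<Gamma> s')" "y \<notin> ?g ` ?T" for y
  proof (rule ccontr)
    assume nz: "twist_kernel z n (\<sigma>, d) y \<noteq> 0"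
    obtain \<tau> e where y_eq: "y = (\<tau>, e)" by (metis prod.exhaust)
    \<comment> \<open>The only candidate for the preimage of \<open>y\<close> under
      \<open>?g\<close>; a nonzero coefficient forces its entries to be signs with product
      1.\<close>
    define a where "a = (\<lambda>j\<in>{..<n}. e j / (d j * lift_sign n \<sigma> j))"
    have \<tau>: "\<tau> = \<sigma>" using nz by (auto simp: y_eq twist_kernel_def split: if_splits)
    have "twist_kernel z n (\<sigma>, d) y = ?c a"
      by (simp add: y_eq \<tau> twist_kernel_def a_def cong: fourier_coeff_cong)
    then have nz: "?c a \<noteq> 0" using nz by simp
    then have "\<forall>j<n. a j \<in> {1, -1}" by (auto simp: fourier_coeff_def split: if_splits)
    then have "a \<in> sign_vectors n" by (auto simp: sign_vectors_def a_def)
    then have "a \<in> ?T" using nz c0 by auto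
    moreover have "y = ?g a"
      using y(1) d0 by (auto simp: y_eq \<tau> a_def monomial_pairs_def PiE_def extensional_def fun_eq_iff)
    ultimately show False using y(2) by blast
  qed
  have "(\<Sum>a\<in>sign_vectors n. ?c a * F (?g a)) = (\<Sum>a\<in>?T. ?c a * F (?g a))"
    using c0 by (intro sum.mono_neutral_right) auto
  also have "\<dots> = (\<Sum>y\<in>?g ` ?T. twist_kernel z n (\<sigma>, d) y * F y)"
    by (simp only: sum.reindex[OF g_inj] comp_def kernel_g)
  also have "\<dots> = (\<Sum>y\<in>carrier (\<Gamma> s'). twist_kernel z n (\<sigma>, d) y * F y)"
    using g_closed outside by (intro sum.mono_neutral_left finite_carrier) auto
  finally show ?thesis ..
qed

text \<open>The lift sign enters twice and cancels. What remains is a convolution of two elements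
  whose values at every character are mutually inverse, hence the coefficients of the
  identity.\<close>

lemma twist_kernel_inverse:
  assumes zw: "z * w = 1" and h: "h \<in> carrier (\<Gamma> s)" and k: "k \<in> carrier (\<Gamma> s)"
  shows "(\<Sum>x\<in>carrier (\<Gamma> s'). twist_kernel z n h x * twist_kernel w n x k) = (if h = k then 1 else 0)"
proof -
  obtain \<sigma> d \<tau> e where hk: "h = (\<sigma>, d)" "k = (\<tau>, e)" by (metis prod.exhaust)
  have d: "d \<in> {..<n} \<rightarrow>\<^sub>E C" and e: "e \<in> {..<n} \<rightarrow>\<^sub>E C"
    using h k by (auto simp: hk monomial_pairs_def)
  have d0: "d j \<noteq> 0" if "j < n" for j using d that by (intro C_closed(2)) auto
  let ?c = "fourier_coeff n (split_weight z n \<sigma>)" and ?c' = "fourier_coeff n (split_weight w n \<sigma>)"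
  have sum: "(\<Sum>x\<in>carrier (\<Gamma> s'). twist_kernel z n h x * twist_kernel w n x k) =
      (\<Sum>a\<in>sign_vectors n. ?c a *
        twist_kernel w n (\<sigma>, \<lambda>j\<in>{..<n}. d j * lift_sign n \<sigma> j * a j) k)"
    using h unfolding hk(1) by (rule sum_twist_kernel)
  show ?thesis
  proof (cases "\<sigma> = \<tau>")
    case True
    \<comment> \<open>The factor \<open>a (id j)\<close> gives the shape of
      \<open>fourier_coeff_convolution\<close> with the identity permutation.\<close>
    have "twist_kernel w n (\<sigma>, \<lambda>j\<in>{..<n}. d j * lift_sign n \<sigma> j * a j) k = ?c' (\<lambda>j. e j / d j * a (id j))"
      if a: "a \<in> sign_vectors n" for a
    proof -
      have "e j / (d j * lift_sign n \<sigma> j * a j * lift_sign n \<sigma> j) = e j / d j * a j" if "j < n" for j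
        using sign_vectorsD[OF a that] lift_sign_cases[of n \<sigma> j] by auto
      then show ?thesis
        by (auto simp: hk True[symmetric] twist_kernel_def intro!: fourier_coeff_cong)
    qed
    then have "(\<Sum>x\<in>carrier (\<Gamma> s'). twist_kernel z n h x * twist_kernel w n x k) =
        (\<Sum>a\<in>sign_vectors n. ?c a * ?c' (\<lambda>j. e j / d j * a (id j)))"
      by (simp only: sum cong: sum.cong)
    also have "\<dots> = fourier_coeff n (\<lambda>S. 1) (\<lambda>j. e j / d j)"
      by (subst fourier_coeff_convolution[OF permutes_id]) (simp add: split_weight_inverse[OF zw])
    also have "\<dots> = (if \<forall>j<n. e j / d j = 1 then 1 else 0)" by (rule fourier_coeff_one)
    also have "(\<forall>j<n. e j / d j = 1) \<longleftrightarrow> h = k"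
      using d0 PiE_ext[OF d e] by (auto simp: hk True)
    finally show ?thesis .
  qed (simp add: sum, simp add: hk twist_kernel_def)
qed

text \<open>Both sides vanish unless the permutation of \<open>x\<close> is the composite of
  \<sigma> and \<tau>. In that case the left side is a convolution, and the cocycle identity
  rewrites its values as those of the composite times a character evaluated at the defect of Tits'
  lift; this factor becomes a translation.\<close>

lemma twist_kernel_mult:
  assumes z: "z * z = -1" and h: "h \<in> carrier (\<Gamma> s)" and k: "k \<in> carrier (\<Gamma> s)" and x: "x \<in> carrier (\<Gamma> s')"
  shows "(\<Sum>y\<in>carrier (\<Gamma> s'). twist_kernel z n h y * twist_kernel z n k (inv\<^bsub>\<Gamma> s'\<^esub> y \<otimes>\<^bsub>\<Gamma> s'\<^esub> x)) =
    twist_kernel z n (h \<otimes>\<^bsub>\<Gamma> s\<^esub> k) x"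
proof -
  obtain \<sigma> d \<tau> e \<pi> f where hkx: "h = (\<sigma>, d)" "k = (\<tau>, e)" "x = (\<pi>, f)" by (metis prod.exhaust)
  have perm: "\<sigma> permutes {..<n}" "\<tau> permutes {..<n}" "\<pi> permutes {..<n}"
    using h k x by (auto simp: hkx monomial_pairs_def)
  have \<tau>n: "\<tau> j < n" if "j < n" for j using permutes_less[OF perm(2) that] .
  have \<pi>n: "\<pi> j < n" if "j < n" for j using permutes_less[OF perm(3) that] .
  let ?c = "\<lambda>\<sigma>. fourier_coeff n (split_weight z n \<sigma>)"
  let ?i = "inv_into UNIV \<sigma>"
  have sum: "(\<Sum>y\<in>carrier (\<Gamma> s'). twist_kernel z n h y * twist_kernel z n k (inv\<^bsub>\<Gamma> s'\<^esub> y \<otimes>\<^bsub>\<Gamma> s'\<^esub> x)) =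
      (\<Sum>a\<in>sign_vectors n. ?c \<sigma> a * twist_kernel z n k
        (pair_inv (\<sigma>, \<lambda>j\<in>{..<n}. d j * lift_sign n \<sigma> j * a j) \<otimes>\<^bsub>\<Gamma> s'\<^esub> x))"
    using h unfolding hkx(1)
    by (simp add: inv_pairs[OF s'] cong: sum.cong) (rule sum_twist_kernel)
  have fst_eq: "fst (pair_inv (\<sigma>, g) \<otimes>\<^bsub>\<Gamma> s'\<^esub> x) = ?i \<circ> \<pi>" for g
    by (simp add: pair_inv_def monomial_pairs_def hkx)
  have fst_mult: "fst (h \<otimes>\<^bsub>\<Gamma> s\<^esub> k) = \<sigma> \<circ> \<tau>"
    by (simp add: monomial_pairs_def hkx)
  show ?thesis
  proof (cases "\<pi> = \<sigma> \<circ> \<tau>")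
    case True
    \<comment> \<open>\<open>X\<close> is the diagonal part of \<open>x\<close> divided by that of
      the product of the two lifted elements before twisting, and \<delta> compares this product of
      lifts with the lift of the composite. Hence \<open>X j * \<delta> j\<close> is the argument in
      the kernel of the product.\<close>
    define X where "X j = f j / (d (\<tau> j) * lift_sign n \<sigma> (\<tau> j) * e j * lift_sign n \<tau> j)" for j
    define \<delta> where "\<delta> j = lift_sign n \<sigma> (\<tau> j) * lift_sign n \<tau> j * lift_sign n (\<sigma> \<circ> \<tau>) j" for j
    have i: "?i \<circ> \<pi> = \<tau>" "?i (\<pi> j) = \<tau> j" for j
      using permutes_inverses[OF perm(1)] by (auto simp: True)
    have "twist_kernel z n k (pair_inv (\<sigma>, \<lambda>j\<in>{..<n}. d j * lift_sign n \<sigma> j * a j) \<otimes>\<^bsub>\<Gamma> s'\<^esub> x) =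
        ?c \<tau> (\<lambda>j. X j * a (\<tau> j))" if a: "a \<in> sign_vectors n" for a
    proof -
      have "inverse (d (\<tau> j) * lift_sign n \<sigma> (\<tau> j) * a (\<tau> j)) * f j / (e j * lift_sign n \<tau> j) = X j * a (\<tau> j)"
        if "j < n" for j
        using sign_vectorsD[OF a \<tau>n[OF that]] by (auto simp: X_def field_simps)
      then show ?thesis
        by (auto simp: hkx pair_inv_def monomial_pairs_def twist_kernel_def i \<tau>n \<pi>n intro!: fourier_coeff_cong)
    qed
    then have "(\<Sum>y\<in>carrier (\<Gamma> s'). twist_kernel z n h y * twist_kernel z n k (inv\<^bsub>\<Gamma> s'\<^esub> y \<otimes>\<^bsub>\<Gamma> s'\<^esub> x)) =
        (\<Sum>a\<in>sign_vectors n. ?c \<sigma> a * ?c \<tau> (\<lambda>j. X j * a (\<tau> j)))"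
      by (simp only: sum cong: sum.cong)
    also have "\<dots> = fourier_coeff n (\<lambda>S. split_weight z n \<sigma> (\<tau> ` S) * split_weight z n \<tau> S) X"
      by (rule fourier_coeff_convolution[OF perm(2)])
    also have "\<dots> = fourier_coeff n (\<lambda>S. split_weight z n (\<sigma> \<circ> \<tau>) S * (\<Prod>j\<in>S. \<delta> j)) X"
      unfolding \<delta>_def by (intro fourier_coeff_cong split_weight_cocycle perm z refl)
    also have "\<dots> = ?c (\<sigma> \<circ> \<tau>) (\<lambda>j. X j * \<delta> j)"
    proof (rule fourier_coeff_mult_character)
      show "\<delta> j \<in> {1, -1}" for j
        using lift_sign_cases[of n \<sigma> "\<tau> j"] lift_sign_cases[of n \<tau> j] lift_sign_cases[of n "\<sigma> \<circ> \<tau>" j]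
        by (auto simp: \<delta>_def)
    qed
    also have "\<dots> = twist_kernel z n (h \<otimes>\<^bsub>\<Gamma> s\<^esub> k) x"
    proof -
      have "X j * \<delta> j = f j / (d (\<tau> j) * e j * lift_sign n (\<sigma> \<circ> \<tau>) j)" for j
        using lift_sign_cases[of n "\<sigma> \<circ> \<tau>" j] by (auto simp: X_def \<delta>_def)
      then show ?thesis
        by (auto simp: hkx monomial_pairs_def twist_kernel_def True intro!: fourier_coeff_cong)
    qed
    finally show ?thesis .
  next
    case False
    have "?i \<circ> \<pi> \<noteq> \<tau>"
    proof
      assume "?i \<circ> \<pi> = \<tau>"
      then have "\<sigma> \<circ> \<tau> = (\<sigma> \<circ> ?i) \<circ> \<pi>" by (metis o_assoc)
      then show False using False by (simp add: permutes_inv_o(1)[OF perm(1)])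
    qed
    have "twist_kernel z n k (pair_inv (\<sigma>, g) \<otimes>\<^bsub>\<Gamma> s'\<^esub> x) = 0" for g
      using fst_eq[of g] \<open>?i \<circ> \<pi> \<noteq> \<tau>\<close>
      by (auto simp: hkx(2) twist_kernel_def split: prod.split)
    moreover have "twist_kernel z n (h \<otimes>\<^bsub>\<Gamma> s\<^esub> k) x = 0"
      using fst_mult False by (auto simp: hkx(3) twist_kernel_def split: prod.split)
    ultimately show ?thesis by (simp only: sum mult_zero_right sum.neutral_const)
  qed
qed

lemma twist_kernel_one:
  assumes "x \<in> carrier (\<Gamma> s')"
  shows "twist_kernel z n \<one>\<^bsub>\<Gamma> s\<^esub> x = (if x = \<one>\<^bsub>\<Gamma> s'\<^esub> then 1 else 0)"
proof -
  obtain \<sigma> d where x: "x = (\<sigma>, d)" by (metis prod.exhaust)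
  have d: "d \<in> {..<n} \<rightarrow>\<^sub>E C" using assms by (auto simp: x monomial_pairs_def)
  have "twist_kernel z n \<one>\<^bsub>\<Gamma> s\<^esub> x = (if \<sigma> = id then fourier_coeff n (\<lambda>S. 1) d else 0)"
    by (auto simp: x monomial_pairs_def twist_kernel_def split_weight_id lift_sign_id
        intro!: fourier_coeff_cong)
  moreover have "(\<forall>j<n. d j = 1) \<longleftrightarrow> d = (\<lambda>j\<in>{..<n}. 1)"
    using d by (auto simp: PiE_def extensional_def fun_eq_iff)
  ultimately show ?thesis
    by (simp add: x monomial_pairs_def fourier_coeff_one)
qed

end

lemma twist_kernel_in_subring:
  assumes "subring R complex_field" "1 / 2 \<in> R" "z \<in> R"
  shows "twist_kernel z n h x \<in> R"
proof -
  have "(\<Prod>a\<in>S. \<Prod>b\<in>{..<n} - S. if inverted \<sigma> a b then z else 1) \<in> R" for \<sigma> S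
    using assms subring_complexD(3)[OF assms(1)] by (intro prod_in_subring[OF assms(1)]) simp
  then have "fourier_coeff n (split_weight z n \<sigma>) a \<in> R" for \<sigma> a
    by (intro fourier_coeff_in_subring assms) (simp add: split_weight_def)
  then show ?thesis
    using subring_complexD(2)[OF assms(1)] by (simp add: twist_kernel_def split: prod.split)
qed

text \<open>The cocycle identity needs a square root of -1, here \<open>\<i>\<close>, and its
  inverse \<open>-\<i>\<close> gives the inverse kernel.\<close>

lemma (in twisted_pairs) group_ring_isomorphic_twist:
  assumes R: "subring R complex_field" "1 / 2 \<in> R" "\<i> \<in> R"
  shows "algebra_isomorphic (scalar_ring R) (group_ring (scalar_ring R) (\<Gamma> s)) (group_ring (scalar_ring R) (\<Gamma> s'))"
proof (rule group_ring_isomorphic_kernel[OF R(1) group_pairs[OF s] finite_carrier group_pairs[OF s'] finite_carrier,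
      where P = "twist_kernel \<i> n" and Q = "twist_kernel (- \<i>) n"])
  \<comment> \<open>The inverse law in the other order is the same lemma with the two characters,
    and \<open>\<i>\<close> and \<open>-\<i>\<close>, exchanged.\<close>
  interpret swapped: twisted_pairs C C' n s' s
    by unfold_locales (use s s' s_s' minus_1 in \<open>simp_all add: mult.commute\<close>)
  show "(\<Sum>h\<in>carrier (\<Gamma> s). twist_kernel (- \<i>) n x h * twist_kernel \<i> n h y) = (if x = y then 1 else 0)"
    if "x \<in> carrier (\<Gamma> s')" "y \<in> carrier (\<Gamma> s')" for x y
    using that by (intro swapped.twist_kernel_inverse) auto
qed (use R subring_complexD(6)[OF R(1) R(3)] in
      \<open>simp_all add: twist_kernel_mult twist_kernel_inverse twist_kernel_one twist_kernel_in_subring\<close>)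


section \<open>Monomial matrices\<close>

definition pair_mat :: "nat \<Rightarrow> (nat \<Rightarrow> nat) \<times> (nat \<Rightarrow> complex) \<Rightarrow> complex mat" where
  "pair_mat n = (\<lambda>(\<sigma>, d). mat n n (\<lambda>(i, j). if i = \<sigma> j then d j else 0))"

lemma pair_mat_cong:
  "(\<And>j. j < n \<Longrightarrow> d j = e j) \<Longrightarrow> pair_mat n (\<sigma>, d) = pair_mat n (\<sigma>, e)"
  by (auto simp: pair_mat_def)

text \<open>Matrices are given with the diagonal factor on the left, pairs with it on the right;
  moving it past \<sigma> permutes its entries.\<close>

lemma mat_diag_times_perm_mat:
  "\<sigma> permutes {..<n} \<Longrightarrow> mat_diag n t * perm_mat n \<sigma> = pair_mat n (\<sigma>, \<lambda>j\<in>{..<n}. t (\<sigma> j))"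
  by (subst mat_diag_mult_left[of _ n n]) (auto simp: perm_mat_def pair_mat_def)

lemma pair_mat_mult:
  assumes "\<tau> permutes {..<n}"
  shows "pair_mat n (\<sigma>, d) * pair_mat n (\<tau>, e) = pair_mat n (\<sigma> \<circ> \<tau>, \<lambda>j\<in>{..<n}. d (\<tau> j) * e j)"
proof (rule eq_matI)
  fix i j assume "i < dim_row (pair_mat n (\<sigma> \<circ> \<tau>, \<lambda>j\<in>{..<n}. d (\<tau> j) * e j))"
    and "j < dim_col (pair_mat n (\<sigma> \<circ> \<tau>, \<lambda>j\<in>{..<n}. d (\<tau> j) * e j))"
  then have ij: "i < n" "j < n" by (simp_all add: pair_mat_def)
  have "(pair_mat n (\<sigma>, d) * pair_mat n (\<tau>, e)) $$ (i, j) =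
      (\<Sum>k = 0..<n. (if i = \<sigma> k then d k else 0) * (if k = \<tau> j then e j else 0))"
    using ij by (simp add: pair_mat_def scalar_prod_def)
  also have "\<dots> = (\<Sum>k = 0..<n. if k = \<tau> j then (if i = \<sigma> k then d k else 0) * e j else 0)"
    by (intro sum.cong) auto
  also have "\<dots> = pair_mat n (\<sigma> \<circ> \<tau>, \<lambda>j\<in>{..<n}. d (\<tau> j) * e j) $$ (i, j)"
    using ij permutes_less[OF assms] by (simp add: pair_mat_def)
  finally show "(pair_mat n (\<sigma>, d) * pair_mat n (\<tau>, e)) $$ (i, j) =
      pair_mat n (\<sigma> \<circ> \<tau>, \<lambda>j\<in>{..<n}. d (\<tau> j) * e j) $$ (i, j)" .
qed (simp_all add: pair_mat_def)

text \<open>In the Leibniz formula only the inverse of \<sigma> meets no zero entry, and it has the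
  same sign as \<sigma>.\<close>

lemma det_perm_mat:
  assumes \<sigma>: "\<sigma> permutes {..<n}"
  shows "det (perm_mat n \<sigma>) = of_int (sign \<sigma>)"
proof -
  let ?i = "inv_into UNIV \<sigma>"
  have i: "?i permutes {0..<n}" using permutes_inv[OF \<sigma>] by (simp add: atLeast0LessThan)
  have zero: "(\<Prod>j = 0..<n. perm_mat n \<sigma> $$ (j, p j)) = 0"
    if p: "p permutes {0..<n}" "p \<noteq> ?i" for p
  proof -
    have pn: "p j < n" if "j < n" for j
      using permutes_less[of p n] p(1) that by (simp add: atLeast0LessThan)
    have "\<exists>j<n. j \<noteq> \<sigma> (p j)"
    proof (rule ccontr)
      assume "\<not> ?thesis"
      then have *: "\<sigma> (p j) = j" if "j < n" for j using that by metis
      have "\<sigma> (p j) = j" for j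
      proof (cases "j < n")
        case False
        then have "p j = j" "\<sigma> j = j"
          using permutes_not_in[OF p(1), of j] permutes_not_in[OF \<sigma>, of j] by auto
        then show ?thesis by simp
      qed (rule *)
      then have "p j = ?i j" for j by (metis permutes_inverses(2)[OF \<sigma>])
      with p(2) show False by blast
    qed
    then obtain j where "j < n" "j \<noteq> \<sigma> (p j)" by blast
    then have "perm_mat n \<sigma> $$ (j, p j) = 0" using pn by (simp add: perm_mat_def)
    then show ?thesis using \<open>j < n\<close> by (intro prod_zero) auto
  qed
  have one: "(\<Prod>j = 0..<n. perm_mat n \<sigma> $$ (j, ?i j)) = 1"
    using permutes_less[OF permutes_inv[OF \<sigma>]] permutes_inverses(1)[OF \<sigma>]
    by (intro prod.neutral) (auto simp: perm_mat_def)
  have "det (perm_mat n \<sigma>) = (\<Sum>p | p permutes {0..<n}. signof p * (\<Prod>j = 0..<n. perm_mat n \<sigma> $$ (j, p j)))"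
    by (rule det_def') (simp add: perm_mat_def)
  also have "\<dots> = (\<Sum>p\<in>{?i}. signof p * (\<Prod>j = 0..<n. perm_mat n \<sigma> $$ (j, p j)))"
    using i zero by (intro sum.mono_neutral_right) (auto simp: finite_permutations)
  also have "\<dots> = of_int (sign ?i)" by (simp add: one)
  also have "sign ?i = sign \<sigma>" using \<sigma> by (intro sign_inverse permutes_imp_permutation) auto
  finally show ?thesis .
qed

lemma det_mat_diag: "det (mat_diag n t) = (\<Prod>j<n. t j)"
proof -
  have "upper_triangular (mat_diag n t)" by (auto simp: mat_diag_def)
  then have "det (mat_diag n t) = prod_list (diag_mat (mat_diag n t))"
    by (rule det_upper_triangular[OF _ mat_diag_dim])
  also have "\<dots> = (\<Prod>j<n. t j)"
    by (simp add: prod_list_diag_prod mat_diag_def atLeast0LessThan)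
  finally show ?thesis .
qed

section \<open>The matrix groups as groups of pairs\<close>

context monomial_pair_data
begin

lemma pair_mat_iso:
  assumes s: "sign_character n s"
  shows "pair_mat n \<in> Group.iso (\<Gamma> s) ((GL n)\<lparr>carrier := pair_mat n ` carrier (\<Gamma> s)\<rparr>)"
proof -
  have "inj_on (pair_mat n) (carrier (\<Gamma> s))"
  proof (rule inj_onI)
    fix x y assume x: "x \<in> carrier (\<Gamma> s)" and y: "y \<in> carrier (\<Gamma> s)" and eq: "pair_mat n x = pair_mat n y"
    obtain \<sigma> d \<tau> e where xy: "x = (\<sigma>, d)" "y = (\<tau>, e)" by (metis prod.exhaust)
    have perm: "\<sigma> permutes {..<n}" "\<tau> permutes {..<n}" and de: "d \<in> {..<n} \<rightarrow>\<^sub>E C" "e \<in> {..<n} \<rightarrow>\<^sub>E C"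
      using x y by (auto simp: xy monomial_pairs_def)
    \<comment> \<open>The nonzero entry in column \<open>j\<close> determines both its row and its
      value.\<close>
    have *: "\<sigma> j = \<tau> j \<and> d j = e j" if j: "j < n" for j
    proof -
      have "pair_mat n x $$ (\<sigma> j, j) = d j"
        "pair_mat n y $$ (\<sigma> j, j) = (if \<sigma> j = \<tau> j then e j else 0)"
        using j permutes_less[OF perm(1) j] by (simp_all add: xy pair_mat_def)
      moreover have "d j \<noteq> 0" using de j by (intro C_closed(2)) auto
      ultimately show ?thesis using eq by (auto split: if_splits)
    qed
    have "\<sigma> j = \<tau> j" for j
      using * permutes_not_in[OF perm(1), of j] permutes_not_in[OF perm(2), of j] by (cases "j < n") auto
    moreover have "d = e" using * by (intro PiE_ext[OF de]) auto
    ultimately show "x = y" by (auto simp: xy)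
  qed
  moreover have "pair_mat n (x \<otimes>\<^bsub>\<Gamma> s\<^esub> y) = pair_mat n x * pair_mat n y"
    if "x \<in> carrier (\<Gamma> s)" "y \<in> carrier (\<Gamma> s)" for x y
  proof -
    obtain \<sigma> d \<tau> e where xy: "x = (\<sigma>, d)" "y = (\<tau>, e)" by (metis prod.exhaust)
    have "\<tau> permutes {..<n}" using that by (simp add: xy monomial_pairs_def)
    then show ?thesis by (simp add: xy pair_mat_mult) (simp add: monomial_pairs_def)
  qed
  ultimately show ?thesis
    by (auto simp: Group.iso_def hom_def bij_betw_def GL_def units_of_mult ring_mat_simps)
qed

text \<open>The group axioms are transported along \<open>pair_mat\<close>, which sends the unit
  pair to the identity matrix.\<close>

lemma group_pair_mats:
  assumes s: "sign_character n s"
  shows "group ((GL n)\<lparr>carrier := pair_mat n ` carrier (\<Gamma> s)\<rparr>)" (is "group ?K")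
proof -
  have "pair_mat n \<one>\<^bsub>\<Gamma> s\<^esub> = \<one>\<^bsub>?K\<^esub>"
    by (auto simp: monomial_pairs_def pair_mat_def GL_def units_of_one ring_mat_simps)
  then have "?K\<lparr>one := pair_mat n \<one>\<^bsub>\<Gamma> s\<^esub>\<rparr> = ?K" by simp
  then show ?thesis
    using group.iso_imp_img_group[OF group_pairs[OF s] pair_mat_iso[OF s]] by simp
qed

text \<open>\<open>Q\<close> stands for either determinant condition, on \<open>t\<close> alone or
  on \<open>t * w\<close>, so both groups are identified with pairs at once.\<close>

lemma pair_mat_image:
  assumes Q: "\<And>\<sigma> t. \<sigma> permutes {..<n} \<Longrightarrow> Q (mat_diag n t) (perm_mat n \<sigma>) \<longleftrightarrow> s \<sigma> * (\<Prod>j<n. t j) \<in> C'"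
  shows "{t * w | t w. t \<in> diag_mats C n \<and> w \<in> perm_mats n \<and> Q t w} = pair_mat n ` carrier (\<Gamma> s)"
proof (intro Set.equalityI subsetI)
  fix M assume "M \<in> {t * w | t w. t \<in> diag_mats C n \<and> w \<in> perm_mats n \<and> Q t w}"
  then obtain t \<sigma> where \<sigma>: "\<sigma> permutes {..<n}" and M: "M = mat_diag n t * perm_mat n \<sigma>"
    and t: "\<forall>i<n. t i \<in> C" and Qt: "Q (mat_diag n t) (perm_mat n \<sigma>)"
    by (auto simp: diag_mats_def perm_mats_def)
  have "(\<Prod>j<n. t (\<sigma> j)) = (\<Prod>j<n. t j)"
    by (rule prod.reindex_bij_betw[OF permutes_imp_bij[OF \<sigma>]])
  then have "(\<sigma>, \<lambda>j\<in>{..<n}. t (\<sigma> j)) \<in> carrier (\<Gamma> s)"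
    using \<sigma> t Q[OF \<sigma>] Qt permutes_less[OF \<sigma>] by (auto simp: monomial_pairs_def)
  then show "M \<in> pair_mat n ` carrier (\<Gamma> s)"
    unfolding M mat_diag_times_perm_mat[OF \<sigma>] by (rule imageI)
next
  fix M assume "M \<in> pair_mat n ` carrier (\<Gamma> s)"
  then obtain \<sigma> d where \<sigma>: "\<sigma> permutes {..<n}" and d: "d \<in> {..<n} \<rightarrow>\<^sub>E C"
    and C': "s \<sigma> * (\<Prod>j<n. d j) \<in> C'" and M: "M = pair_mat n (\<sigma>, d)"
    by (auto simp: monomial_pairs_def)
  let ?t = "\<lambda>i. d (inv_into UNIV \<sigma> i)"
  have i: "inv_into UNIV \<sigma> permutes {..<n}" by (rule permutes_inv[OF \<sigma>])
  have "(\<Prod>j<n. ?t j) = (\<Prod>j<n. d j)"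
    by (rule prod.reindex_bij_betw[OF permutes_imp_bij[OF i]])
  then have "Q (mat_diag n ?t) (perm_mat n \<sigma>)" using Q[OF \<sigma>] C' by simp
  moreover have "M = mat_diag n ?t * perm_mat n \<sigma>"
    unfolding M mat_diag_times_perm_mat[OF \<sigma>] by (rule pair_mat_cong) (simp add: permutes_inverses[OF \<sigma>])
  moreover have "mat_diag n ?t \<in> diag_mats C n"
    using d permutes_less[OF i] by (auto simp: diag_mats_def)
  moreover have "perm_mat n \<sigma> \<in> perm_mats n" using \<sigma> by (auto simp: perm_mats_def)
  ultimately show "M \<in> {t * w | t w. t \<in> diag_mats C n \<and> w \<in> perm_mats n \<and> Q t w}" by blast
qed

lemma imprimitive_group_eq:
  "imprimitive_group C C' n = (GL n)\<lparr>carrier := pair_mat n ` carrier (\<Gamma> (\<lambda>_. 1))\<rparr>"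
proof -
  have "{t * w | t w. t \<in> diag_mats C n \<and> w \<in> perm_mats n \<and> det t \<in> C'} =
      pair_mat n ` carrier (\<Gamma> (\<lambda>_. 1))"
    by (rule pair_mat_image) (simp add: det_mat_diag)
  then show ?thesis by (simp add: imprimitive_group_def)
qed

lemma mystic_group_eq:
  "mystic_group C C' n = (GL n)\<lparr>carrier := pair_mat n ` carrier (\<Gamma> (\<lambda>\<sigma>. of_int (sign \<sigma>)))\<rparr>"
proof -
  have "{t * w | t w. t \<in> diag_mats C n \<and> w \<in> perm_mats n \<and> det (t * w) \<in> C'} =
      pair_mat n ` carrier (\<Gamma> (\<lambda>\<sigma>. of_int (sign \<sigma>)))"
  proof (rule pair_mat_image)
    fix \<sigma> t assume "\<sigma> permutes {..<n}"
    moreover have "det (mat_diag n t * perm_mat n \<sigma>) = det (mat_diag n t) * det (perm_mat n \<sigma>)"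
      by (rule det_mult[of _ n]) (simp_all add: perm_mat_def)
    ultimately show "det (mat_diag n t * perm_mat n \<sigma>) \<in> C' \<longleftrightarrow> of_int (sign \<sigma>) * (\<Prod>j<n. t j) \<in> C'"
      by (simp add: det_mat_diag det_perm_mat mult.commute)
  qed
  then show ?thesis by (simp add: mystic_group_def)
qed

text \<open>Three isomorphisms are composed: from matrices to pairs for the trivial character, the
  twist to the sign character, and back to matrices.\<close>

lemma group_ring_isomorphic_imprimitive_mystic:
  assumes minus_1: "-1 \<in> C" and R: "subring R complex_field" "1 / 2 \<in> R" "\<i> \<in> R"
  shows "algebra_isomorphic (scalar_ring R)
    (group_ring (scalar_ring R) (imprimitive_group C C' n)) (group_ring (scalar_ring R) (mystic_group C C' n))"
proof -
  let ?s = "\<lambda>_. 1" and ?s' = "\<lambda>\<sigma>. of_int (sign \<sigma>)"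
  have s: "sign_character n ?s" by (simp add: sign_character_def)
  have "sign (\<sigma> \<circ> \<tau>) = sign \<sigma> * sign \<tau>" if "\<sigma> permutes {..<n}" "\<tau> permutes {..<n}" for \<sigma> \<tau>
    using that permutes_imp_permutation[OF finite_lessThan] by (intro sign_compose)
  then have s': "sign_character n ?s'"
    by (simp add: sign_character_def flip: of_int_mult)
  interpret twisted_pairs C C' n ?s ?s'
    by unfold_locales (use s s' minus_1 in simp_all)
  have "inv_into (carrier (\<Gamma> ?s)) (pair_mat n) \<in> Group.iso (imprimitive_group C C' n) (\<Gamma> ?s)"
    unfolding imprimitive_group_eq by (rule group.iso_set_sym[OF group_pairs[OF s] pair_mat_iso[OF s]])
  then have "algebra_isomorphic (scalar_ring R)
      (group_ring (scalar_ring R) (imprimitive_group C C' n)) (group_ring (scalar_ring R) (\<Gamma> ?s))"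
    by (rule group_ring_isomorphic_iso[OF R(1), rotated 3])
      (auto simp: imprimitive_group_eq group_pair_mats group_pairs s finite_carrier)
  moreover have "algebra_isomorphic (scalar_ring R)
      (group_ring (scalar_ring R) (\<Gamma> ?s)) (group_ring (scalar_ring R) (\<Gamma> ?s'))"
    by (rule group_ring_isomorphic_twist[OF R])
  moreover have "algebra_isomorphic (scalar_ring R)
      (group_ring (scalar_ring R) (\<Gamma> ?s')) (group_ring (scalar_ring R) (mystic_group C C' n))"
    unfolding mystic_group_eq
    by (rule group_ring_isomorphic_iso[OF R(1) group_pairs[OF s'] finite_carrier group_pair_mats[OF s'] pair_mat_iso[OF s']])
  ultimately show ?thesis by (blast intro: algebra_isomorphic_trans)
qed

end

section \<open>Finite subgroups of the complex units and the coefficient ring\<close>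

lemma mult_closed_units_subgroup:
  assumes "subgroup C complex_units"
  shows "mult_closed_units C"
proof -
  interpret U: group complex_units by (rule monoid.units_group[OF ring.axioms(2)[OF class_ring.ring_axioms]])
  interpret subgroup C complex_units by (rule assms)
  have "\<exists>y. y * x = 1 \<and> x * y = 1" if "x \<noteq> 0" for x :: complex
    using that by (intro exI[of _ "inverse x"]) simp
  then have units: "carrier complex_units = UNIV - {0}"
    by (auto simp: units_of_def Units_def)
  have ops: "x \<otimes>\<^bsub>complex_units\<^esub> y = x * y" "\<one>\<^bsub>complex_units\<^esub> = 1" for x y
    by (simp_all add: units_of_def)
  have "inverse x \<in> C" if "x \<in> C" for x
  proof -
    have "x \<noteq> 0" using that subset units by auto
    then have "inv\<^bsub>complex_units\<^esub> x = inverse x"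
      by (intro U.inv_equality) (simp_all add: ops units)
    then show ?thesis using m_inv_closed[OF that] by simp
  qed
  then show ?thesis
    using one_closed m_closed subset by (auto simp: mult_closed_units_def ops units)
qed

text \<open>Multiplication by an element of \<open>C\<close> permutes \<open>C\<close>; comparing
  products shows that its power with exponent \<open>card C\<close> is 1. By counting,
  \<open>C\<close> consists of all roots of unity of this even order, and -1 is one of them.\<close>

lemma minus_1_in_even_mult_closed_units:
  assumes C: "mult_closed_units C" "finite C" and "even (card C)"
  shows "-1 \<in> C"
proof -
  have pos: "card C > 0" using C by (auto simp: mult_closed_units_def card_gt_0_iff)
  have "x ^ card C = 1" if x: "x \<in> C" for x
  proof -
    have "x \<noteq> 0" using C x by (auto simp: mult_closed_units_def)
    then have "bij_betw ((*) x) C C"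
      using C x
      by (intro bij_betw_byWitness[where f' = "(*) (inverse x)"]) (auto simp: mult_closed_units_def)
    then have "(\<Prod>y\<in>C. x * y) = \<Prod>C" by (rule prod.reindex_bij_betw)
    moreover have "\<Prod>C \<noteq> 0" using C by (auto simp: mult_closed_units_def)
    ultimately show ?thesis by (simp add: prod.distrib)
  qed
  then have "C = {x. x ^ card C = 1}"
    using card_roots_unity_eq[OF pos] finite_roots_unity[of "card C"] pos
    by (intro card_subset_eq) auto
  moreover have "(-1 :: complex) ^ card C = 1" using assms(3) by simp
  ultimately show ?thesis by blast
qed

lemma coeff_ring_facts:
  defines "R \<equiv> generate_ring complex_field {(1 + \<i>) / 2}"
  shows "subring R complex_field" "1 / 2 \<in> R" "\<i> \<in> R"
proof -
  have ring: "ring complex_field" by (rule class_ring.ring_axioms)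
  show R: "subring R complex_field"
    unfolding R_def by (rule ring.generate_ring_is_subring[OF ring]) simp
  let ?w = "(1 + \<i>) / 2"
  have w: "?w \<in> R" unfolding R_def by (rule generate_ring.incl) simp
  \<comment> \<open>The square of the generator is \<open>\<i> / 2\<close>. Doubling gives
    \<open>\<i>\<close>, and \<open>\<i>\<close> times \<open>\<i> / 2\<close> is -1/2.\<close>
  have half_i: "\<i> / 2 \<in> R"
    using subring_complexD(5)[OF R w w] by (simp add: field_simps)
  show i: "\<i> \<in> R" using subring_complexD(4)[OF R half_i half_i] by simp
  show "1 / 2 \<in> R"
    using subring_complexD(6)[OF R subring_complexD(5)[OF R i half_i]] by simp
qed

theorem theorem2p8:
  fixes n m p :: nat and C C' :: "complex set"
  assumes "n \<ge> 1" and "m \<ge> 2" and "even m" and "p dvd m"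
    and "subgroup C complex_units" and "finite C" and "card C = m"
    and "subgroup C' complex_units" and "finite C'" and "card C' = m div p"
  shows "algebra_isomorphic coeff_ring
           (group_ring coeff_ring (imprimitive_group C C' n))
           (group_ring coeff_ring (mystic_group C C' n))
       \<and> algebra_isomorphic complex_field
           (group_ring complex_field (imprimitive_group C C' n))
           (group_ring complex_field (mystic_group C C' n))"
proof -
  interpret monomial_pair_data C C' n
    using assms by unfold_locales (auto intro: mult_closed_units_subgroup)
  have minus_1: "-1 \<in> C"
    using assms by (intro minus_1_in_even_mult_closed_units mult_closed_units_subgroup) auto
  \<comment> \<open>The claim over the complex numbers is the instance \<open>UNIV\<close>, which
    contains 1/2 and \<open>\<i>\<close>.\<close>
  have "subring UNIV complex_field"
    by (rule ring.subringI[OF class_ring.ring_axioms]) auto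
  then show ?thesis
    using group_ring_isomorphic_imprimitive_mystic[OF minus_1 coeff_ring_facts]
      group_ring_isomorphic_imprimitive_mystic[OF minus_1, of UNIV]
    by (simp add: coeff_ring_def)
qed

end
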